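(* Let $X=\mathbb{R}$, let $(\mu_\alpha)$ be a net of Radon sub-probability measures on $X$ and $(t_\alpha)$ a net in $]0,+\infty[$ converging to $0$. Let $\mathcal{S}\subset\mathcal{C}(X)$ and let $G\subset X$ be a nonempty open interval such that $\mathcal{S}\supset\{h_\lambda:\lambda\in G\}$. Assume that $\Lambda(h)$ exists for all $h\in\mathcal{S}$ and that $L(\lambda)$ is finite for all $\lambda\in G$. Put $R=\mathrm{ran}\,{L_{\mid G}}'_-\cup\mathrm{ran}\,{L_{\mid G}}'_+$. (a) If $R\supset \mathrm{Dom}(l_0)\cap\{l_1>-\overline{\Lambda}(0)\}$, then $(\mu_\alpha)$ satisfies a vague large deviation principle with powers $(t_\alpha)$ and a rate function $J$ satisfying $$J(x)={L_{\mid G}}^*(x)={\Lambda_{\mid\mathcal{S}}}^*(x)\quad\text{for all }x\in\mathrm{Dom}(J)\cap\{J>-\overline{\Lambda}(0)\}.$$ If moreover $0\in G$, then the principle is narrow and $J(x)={L_{\mid G}}^*(x)={\Lambda_{\mid\mathcal{S}}}^*(x)$ for all $x\in\mathrm{Dom}(J)$. (b) If $R\supset\mathrm{Dom}(l_0)$, then $(\mu_\alpha)$ satisfies a vague large deviation principle with powers $(t_\alpha)$ and a rate function $J$ satisfying $$J(x)={L_{\mid G}}^*(x)={\Lambda_{\mid\mathcal{S}}}^*(x)\quad\text{for all }x\in\mathrm{Dom}(J).$$ If moreover $0\in G$, then the principle is narrow. (c) If $R\supset\mathrm{Dom}({\Lambda_{\mid\mathcal{S}}}^* )\cap\{l_1>-\overline{\Lambda}(0)\}$,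 then $(\mu_\alpha)$ satisfies a vague large deviation principle with powers $(t_\alpha)$ and a rate function $J$ satisfying $$J(x)={\Lambda_{\mid\mathcal{S}}}^*(x)\quad\text{for all }x\in\{J>-\overline{\Lambda}(0)\}$$ and $$J(x)={L_{\mid G}}^*(x)\quad\text{for all }x\in\mathrm{Dom}({\Lambda_{\mid\mathcal{S}}}^* )\cap\{J>-\overline{\Lambda}(0)\}.$$ If moreover $0\in G$, then the principle is narrow with $J={\Lambda_{\mid\mathcal{S}}}^*$ satisfying $J(x)={L_{\mid G}}^*(x)$ for all $x\in\mathrm{Dom}(J)$. (d) If $R\supset\mathrm{Dom}({\Lambda_{\mid\mathcal{S}}}^* )$, then $(\mu_\alpha)$ satisfies a vague large deviation principle with powers $(t_\alpha)$ and rate function $J={\Lambda_{\mid\mathcal{S}}}^*$ satisfying $$J(x)={L_{\mid G}}^*(x)\quad\text{for all }x\in\mathrm{Dom}(J).$$ If moreover $0\in G$, then the principle is narrow. (e) Assume that $l_0$ is proper convex. (e1) If $R\supset \mathrm{int\,Dom}(l_0)\cap\{l_1>-\overline{\Lambda}(0)\}$, then $(\mu_\alpha)$ satisfies a vague large deviation principle with powers $(t_\alpha)$ and a rate function $J$ satisfying $J(x)={L_{\mid G}}^*(x)={\Lambda_{\mid\mathcal{S}}}^*(x)$ for all $x\in\mathrm{int\,Dom}(J)\cap\{J>-\overline{\Lambda}(0)\}$. If moreover $0\in G$, then the principle is narrow and $J(x)={L_{\mid G}}^*(x)={\Lambda_{\mid\mathcal{S}}}^*(x)$ for all $x\in\mathrm{int\,Dom}(J)$.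 (e2) If $R\supset\mathrm{int\,Dom}(l_0)$, then $(\mu_\alpha)$ satisfies a vague large deviation principle with powers $(t_\alpha)$ and a rate function $J$ satisfying $J(x)={L_{\mid G}}^*(x)={\Lambda_{\mid\mathcal{S}}}^*(x)$ for all $x\in\mathrm{int\,Dom}(J)$. If moreover $0\in G$, then the principle is narrow. (f) Assume that ${\Lambda_{\mid\mathcal{S}}}^*$ is proper convex and lower semi-continuous. (f1) If $R\supset\mathrm{int\,Dom}({\Lambda_{\mid\mathcal{S}}}^* )\cap\{l_1>-\overline{\Lambda}(0)\}$, then $(\mu_\alpha)$ satisfies a vague large deviation principle with powers $(t_\alpha)$ and a rate function $J$ satisfying $J(x)={\Lambda_{\mid\mathcal{S}}}^*(x)$ for all $x\in\{J>-\overline{\Lambda}(0)\}$ and $J(x)={L_{\mid G}}^*(x)$ for all $x\in\mathrm{int\,Dom}({\Lambda_{\mid\mathcal{S}}}^* )\cap\{J>-\overline{\Lambda}(0)\}$. If moreover $0\in G$, then the principle is narrow with $J={\Lambda_{\mid\mathcal{S}}}^*$ satisfying $J(x)={L_{\mid G}}^*(x)$ for all $x\in\mathrm{int\,Dom}(J)$. (f2) If $R\supset\mathrm{int\,Dom}({\Lambda_{\mid\mathcal{S}}}^* )$, then $(\mu_\alpha)$ satisfies a vague large deviation principle with powers $(t_\alpha)$ and rate function $J={\Lambda_{\mid\mathcal{S}}}^*$ satisfying $J(x)={L_{\mid G}}^*(x)$ for all $x\in\mathrm{int\,Dom}(J)$. If moreover $0\in G$, then the principle is narrow.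
   Context: $\mathcal{B}(X)$ (resp. $\mathcal{C}(X)$) is the set of $[-\infty,+\infty[$-valued Borel measurable (resp. continuous) functions on $X$. For a Borel set $Y$, $\mu_\alpha^{t_\alpha}(Y)=(\mu_\alpha(Y))^{t_\alpha}$. For $h\in\mathcal{B}(X)$, $\mu_\alpha^{t_\alpha}(e^{h/t_\alpha})=\left(\int_X e^{h(x)/t_\alpha}\mu_\alpha(dx)\right)^{t_\alpha}$, $$\underline{\Lambda}(h)=\log\liminf_\alpha\mu_\alpha^{t_\alpha}(e^{h/t_\alpha}),\qquad \overline{\Lambda}(h)=\log\limsup_\alpha\mu_\alpha^{t_\alpha}(e^{h/t_\alpha}),$$ with $\log 0=-\infty$, $\log(+\infty)=+\infty$; $\Lambda(h)$ is said to exist, and denotes the common value in $[-\infty,+\infty]$, when both are equal. $\overline{\Lambda}(0)$ is the value at the zero function. For $\lambda\in\mathbb{R}$, $h_\lambda(x)=\lambda x$ and $L(\lambda)=\Lambda(h_\lambda)$ when this exists. For $x\in X$: $l_0(x)=-\log\inf\{\limsup_\alpha\mu_\alpha^{t_\alpha}(V):x\in V\subset X,\ V\text{ open}\}$ and $l_1(x)=-\log\inf\{\liminf_\alpha\mu_\alpha^{t_\alpha}(V):x\in V\subset X,\ V\text{ open}\}$. When $L$ is finite on the open interval $G$, $L_{\mid G}$ is convex; ${L_{\mid G}}'_-$ and ${L_{\mid G}}'_+$ are its left and right derivatives (functions on $G$), $\mathrm{ran}$ denotes the range, and ${L_{\mid G}}^*(x)=\sup_{\lambda\in G}\{\lambda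 x-L(\lambda)\}$. The abstract Legendre-Fenchel transform is ${\Lambda_{\mid\mathcal{S}}}^*(x)=\sup_{h\in\mathcal{S}}\{h(x)-\Lambda(h)\}$, $x\in X$, where $(-\infty)-(-\infty)$ is read as $-\infty$. For a $[-\infty,+\infty]$-valued function $f$, $\mathrm{Dom}(f)=\{f<+\infty\}$ and $\mathrm{int\,Dom}(f)$ is its topological interior; $\{f>c\}=\{x\in X: f(x)>c\}$. A convex function on $\mathbb{R}$ is proper if it never takes the value $-\infty$ and is finite at some point. $(\mu_\alpha)$ satisfies a (narrow) large deviation principle with powers $(t_\alpha)$ and rate function $J$ if $J:X\to[0,+\infty]$ is lower semi-continuous, $\limsup_\alpha\mu_\alpha^{t_\alpha}(F)\le\sup_{x\in F}e^{-J(x)}$ for all closed $F\subset X$, and $\sup_{x\in V}e^{-J(x)}\le\liminf_\alpha\mu_\alpha^{t_\alpha}(V)$ for all open $V\subset X$ (the supremum over the empty set being $0$ here). If "closed" is replaced by "compact" in the upper bound, the principle is called vague. *)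

theory Defs
  imports "HOL-Probability.Giry_Monad"
begin

definition eexp :: "ereal \<Rightarrow> ennreal" where
  "eexp a = (if a = \<infinity> then \<infinity> else if a = -\<infinity> then 0 else ennreal (exp (real_of_ereal a)))"

definition elog :: "ennreal \<Rightarrow> ereal" where
  "elog u = (if u = 0 then -\<infinity> else if u = \<infinity> then \<infinity> else ereal (ln (enn2real u)))"

text \<open>Intended for exponents \<open>s > 0\<close>; in particular \<open>0\<close> is mapped to \<open>0\<close>.\<close>

definition epowr :: "ennreal \<Rightarrow> real \<Rightarrow> ennreal" where
  "epowr u s = (if u = \<infinity> then \<infinity> else ennreal (enn2real u powr s))"

definition radon_subprob :: "'a::topological_space measure \<Rightarrow> bool" where
  "radon_subprob M \<longleftrightarrow> subprob_space M \<and> sets M = sets borel \<and>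
     (\<forall>B\<in>sets borel. emeasure M B = (SUP K\<in>{K. K \<subseteq> B \<and> compact K}. emeasure M K))"

lemma radon_subprob_polish_iff:
  fixes M :: "'a::{second_countable_topology, complete_space} measure"
  shows "radon_subprob M \<longleftrightarrow> subprob_space M \<and> sets M = sets borel"
proof -
  have "emeasure M B = (SUP K\<in>{K. K \<subseteq> B \<and> compact K}. emeasure M K)"
    if M: "subprob_space M" "sets M = sets borel" and B: "B \<in> sets borel" for B
  proof -
    interpret subprob_space M by (rule M(1))
    show ?thesis
      by (rule inner_regular) (use M(2) B in auto)
  qed
  then show ?thesis
    unfolding radon_subprob_def by blast
qed

definition lsc :: "('a::topological_space \<Rightarrow> ereal) \<Rightarrow> bool" where
  "lsc f \<longleftrightarrow> (\<forall>c. closed {x. f x \<le> c})"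

text \<open>Nets are families indexed by a type carrying a proper filter \<open>F\<close>; for a directed index set,
  \<open>F\<close> is the filter generated by the tails, and \<open>Limsup F\<close>, \<open>Liminf F\<close> are the limits superior and
  inferior along the net.\<close>

definition limsup_pow :: "'i filter \<Rightarrow> ('i \<Rightarrow> 'a measure) \<Rightarrow> ('i \<Rightarrow> real) \<Rightarrow> 'a set \<Rightarrow> ennreal" where
  "limsup_pow F \<mu> t Y = Limsup F (\<lambda>i. epowr (emeasure (\<mu> i) Y) (t i))"

definition liminf_pow :: "'i filter \<Rightarrow> ('i \<Rightarrow> 'a measure) \<Rightarrow> ('i \<Rightarrow> real) \<Rightarrow> 'a set \<Rightarrow> ennreal" where
  "liminf_pow F \<mu> t Y = Liminf F (\<lambda>i. epowr (emeasure (\<mu> i) Y) (t i))"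

definition narrow_ldp ::
    "'i filter \<Rightarrow> ('i \<Rightarrow> 'a::topological_space measure) \<Rightarrow> ('i \<Rightarrow> real) \<Rightarrow> ('a \<Rightarrow> ereal) \<Rightarrow> bool" where
  "narrow_ldp F \<mu> t J \<longleftrightarrow> (\<forall>x. 0 \<le> J x) \<and> lsc J \<and>
     (\<forall>C. closed C \<longrightarrow> limsup_pow F \<mu> t C \<le> (SUP x\<in>C. eexp (- J x))) \<and>
     (\<forall>V. open V \<longrightarrow> (SUP x\<in>V. eexp (- J x)) \<le> liminf_pow F \<mu> t V)"

definition vague_ldp ::
    "'i filter \<Rightarrow> ('i \<Rightarrow> 'a::topological_space measure) \<Rightarrow> ('i \<Rightarrow> real) \<Rightarrow> ('a \<Rightarrow> ereal) \<Rightarrow> bool" where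
  "vague_ldp F \<mu> t J \<longleftrightarrow> (\<forall>x. 0 \<le> J x) \<and> lsc J \<and>
     (\<forall>K. compact K \<longrightarrow> limsup_pow F \<mu> t K \<le> (SUP x\<in>K. eexp (- J x))) \<and>
     (\<forall>V. open V \<longrightarrow> (SUP x\<in>V. eexp (- J x)) \<le> liminf_pow F \<mu> t V)"

definition ell0 ::
    "'i filter \<Rightarrow> ('i \<Rightarrow> 'a::topological_space measure) \<Rightarrow> ('i \<Rightarrow> real) \<Rightarrow> 'a \<Rightarrow> ereal" where
  "ell0 F \<mu> t x = - elog (INF V\<in>{V. open V \<and> x \<in> V}. limsup_pow F \<mu> t V)"

definition ell1 ::
    "'i filter \<Rightarrow> ('i \<Rightarrow> 'a::topological_space measure) \<Rightarrow> ('i \<Rightarrow> real) \<Rightarrow> 'a \<Rightarrow> ereal" where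
  "ell1 F \<mu> t x = - elog (INF V\<in>{V. open V \<and> x \<in> V}. liminf_pow F \<mu> t V)"

definition Lam_lower ::
    "'i filter \<Rightarrow> ('i \<Rightarrow> 'a measure) \<Rightarrow> ('i \<Rightarrow> real) \<Rightarrow> ('a \<Rightarrow> ereal) \<Rightarrow> ereal" where
  "Lam_lower F \<mu> t h =
     elog (Liminf F (\<lambda>i. epowr (\<integral>\<^sup>+ x. eexp (h x / ereal (t i)) \<partial>\<mu> i) (t i)))"

definition Lam_upper ::
    "'i filter \<Rightarrow> ('i \<Rightarrow> 'a measure) \<Rightarrow> ('i \<Rightarrow> real) \<Rightarrow> ('a \<Rightarrow> ereal) \<Rightarrow> ereal" where
  "Lam_upper F \<mu> t h =
     elog (Limsup F (\<lambda>i. epowr (\<integral>\<^sup>+ x. eexp (h x / ereal (t i)) \<partial>\<mu> i) (t i)))"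

definition Lam_exists ::
    "'i filter \<Rightarrow> ('i \<Rightarrow> 'a measure) \<Rightarrow> ('i \<Rightarrow> real) \<Rightarrow> ('a \<Rightarrow> ereal) \<Rightarrow> bool" where
  "Lam_exists F \<mu> t h \<longleftrightarrow> Lam_lower F \<mu> t h = Lam_upper F \<mu> t h"

text \<open>Only meaningful where \<open>Lam_exists\<close> holds.\<close>

definition Lam ::
    "'i filter \<Rightarrow> ('i \<Rightarrow> 'a measure) \<Rightarrow> ('i \<Rightarrow> real) \<Rightarrow> ('a \<Rightarrow> ereal) \<Rightarrow> ereal" where
  "Lam F \<mu> t h = Lam_upper F \<mu> t h"

definition hlin :: "real \<Rightarrow> real \<Rightarrow> ereal" where
  "hlin l x = ereal (l * x)"

definition Lfun :: "'i filter \<Rightarrow> ('i \<Rightarrow> real measure) \<Rightarrow> ('i \<Rightarrow> real) \<Rightarrow> real \<Rightarrow> ereal" where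
  "Lfun F \<mu> t l = Lam F \<mu> t (hlin l)"

text \<open>In \<open>ereal\<close>, \<open>(-\<infinity>) - (-\<infinity>) = \<infinity>\<close>; here this difference has to be \<open>-\<infinity>\<close>.\<close>

definition ediff :: "ereal \<Rightarrow> ereal \<Rightarrow> ereal" where
  "ediff a b = (if a = -\<infinity> \<and> b = -\<infinity> then -\<infinity> else a - b)"

definition Lam_star ::
    "'i filter \<Rightarrow> ('i \<Rightarrow> 'a measure) \<Rightarrow> ('i \<Rightarrow> real) \<Rightarrow> ('a \<Rightarrow> ereal) set \<Rightarrow> 'a \<Rightarrow> ereal" where
  "Lam_star F \<mu> t S x = (SUP h\<in>S. ediff (h x) (Lam F \<mu> t h))"

definition L_star ::
    "'i filter \<Rightarrow> ('i \<Rightarrow> real measure) \<Rightarrow> ('i \<Rightarrow> real) \<Rightarrow> real set \<Rightarrow> real \<Rightarrow> ereal" where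
  "L_star F \<mu> t G x = (SUP l\<in>G. ereal (l * x) - Lfun F \<mu> t l)"

definition ran_left_deriv :: "(real \<Rightarrow> real) \<Rightarrow> real set \<Rightarrow> real set" where
  "ran_left_deriv f G = {D. \<exists>l\<in>G. (f has_real_derivative D) (at_left l)}"

definition ran_right_deriv :: "(real \<Rightarrow> real) \<Rightarrow> real set \<Rightarrow> real set" where
  "ran_right_deriv f G = {D. \<exists>l\<in>G. (f has_real_derivative D) (at_right l)}"

text \<open>To be used when \<open>G\<close> is open and \<open>Lfun\<close> is finite on \<open>G\<close>; the conversion to \<open>real\<close> then loses
  nothing on \<open>G\<close>, and the one-sided derivatives at points of \<open>G\<close> are those of the restriction.\<close>

definition slopes ::
    "'i filter \<Rightarrow> ('i \<Rightarrow> real measure) \<Rightarrow> ('i \<Rightarrow> real) \<Rightarrow> real set \<Rightarrow> real set" where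
  "slopes F \<mu> t G =
     ran_left_deriv (\<lambda>l. real_of_ereal (Lfun F \<mu> t l)) G \<union>
     ran_right_deriv (\<lambda>l. real_of_ereal (Lfun F \<mu> t l)) G"

definition Dom :: "('a \<Rightarrow> ereal) \<Rightarrow> 'a set" where
  "Dom f = {x. f x < \<infinity>}"

text \<open>Convexity of an extended-real-valued function is convexity of its epigraph.\<close>

definition proper_convex :: "(real \<Rightarrow> ereal) \<Rightarrow> bool" where
  "proper_convex f \<longleftrightarrow> convex {(x, r :: real). f x \<le> ereal r} \<and>
     (\<forall>x. f x \<noteq> -\<infinity>) \<and> (\<exists>x. \<bar>f x\<bar> \<noteq> \<infinity>)"

end

theory Submission
  imports Defs
begin

text \<open>In every case the rate function is \<open>l0\<close>, and the vague principle amounts to \<open>l0 = l1\<close>; it is narrow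
  when \<open>0 \<in> G\<close> by exponential tightness. One always has \<open>L* \<le> \<Lambda>* \<le> l0 \<le> l1\<close> and
  \<open>-\<Lambda>(0) \<le> l0\<close>. If \<open>x\<close> is a one-sided derivative of \<open>L\<close> at \<open>a\<close>, tilt the measures by \<open>l y\<close>, with \<open>l\<close>
  close to \<open>a\<close> on the relevant side: by Chebyshev's inequality, comparing \<open>l\<close> with a parameter on
  either side, both tails outside a neighbourhood of \<open>x\<close> are negligible against \<open>exp (L l)\<close>, so
  the neighbourhood carries the mass and \<open>l1 x \<le> a x - L a \<le> L* x\<close>. Hence all four functions
  coincide on \<open>R\<close>. In (e) and (f) boundary points of the domain
  are reached by lower semicontinuity of \<open>l1\<close> along segments from the interior.\<close>

section \<open>Exponential, logarithm and powers on the extended half-line\<close>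

lemma eexp_simps [simp]:
  "eexp \<infinity> = \<infinity>" "eexp (- \<infinity>) = 0" "eexp (ereal r) = ennreal (exp r)"
  by (auto simp: eexp_def)

lemma eexp_elog [simp]: "eexp (elog u) = u"
  by (cases u) (auto simp: eexp_def elog_def ennreal_eq_0_iff)

lemma eexp_less_iff [simp]: "eexp a < eexp b \<longleftrightarrow> a < b"
  by (cases a; cases b) (auto simp: ennreal_less_iff)

lemma eexp_le_iff [simp]: "eexp a \<le> eexp b \<longleftrightarrow> a \<le> b"
  by (meson eexp_less_iff linorder_not_less)

lemma epowr_mono: "u \<le> v \<Longrightarrow> 0 < s \<Longrightarrow> epowr u s \<le> epowr v s"
  by (cases u; cases v) (auto simp: epowr_def ennreal_le_iff powr_mono2 top_unique)

lemma epowr_mult: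
  assumes "0 < c"
  shows "epowr (ennreal c * u) s = ennreal (c powr s) * epowr u s"
  using assms
  by (cases u) (auto simp: epowr_def ennreal_mult_top ennreal_mult_eq_top_iff powr_mult
    simp flip: ennreal_mult)

lemma epowr_zero [simp]: "epowr 0 s = 0"
  by (simp add: epowr_def)

lemma epowr_max:
  assumes "0 < s" shows "epowr (max u v) s = max (epowr u s) (epowr v s)"
  by (metis assms epowr_mono linorder_le_cases max.absorb1 max.absorb2)

lemma continuous_on_ennreal_cmult: "continuous_on UNIV ((*) (ennreal c))"
  by (auto simp: continuous_on_def intro!: ennreal_tendsto_cmult)

lemma Limsup_cmult_ennreal:
  assumes "F \<noteq> bot"
  shows "Limsup F (\<lambda>i. ennreal c * u i) = ennreal c * Limsup F u"
  by (rule Limsup_compose_continuous_mono[OF _ _ assms])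
     (auto intro!: monoI mult_left_mono continuous_on_ennreal_cmult)

lemma Liminf_cmult_ennreal:
  assumes "F \<noteq> bot"
  shows "Liminf F (\<lambda>i. ennreal c * u i) = ennreal c * Liminf F u"
  by (rule Liminf_compose_continuous_mono[OF _ _ assms])
     (auto intro!: monoI mult_left_mono continuous_on_ennreal_cmult)

section \<open>Local rates of set functions\<close>

text \<open>Common form of \<open>ell0\<close> and \<open>ell1\<close>: the set function
  \<open>g\<close> is \<open>limsup_pow\<close> for the first and \<open>liminf_pow\<close> for the
  second.\<close>

definition loc_rate :: "('a::topological_space set \<Rightarrow> ennreal) \<Rightarrow> 'a \<Rightarrow> ereal" where
  "loc_rate g x = - elog (INF V\<in>{V. open V \<and> x \<in> V}. g V)"

lemma eexp_minus_loc_rate: "eexp (- loc_rate g x) = (INF V\<in>{V. open V \<and> x \<in> V}. g V)"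
  by (simp add: loc_rate_def)

lemma less_loc_rate_iff: "c < loc_rate g x \<longleftrightarrow> (\<exists>V. open V \<and> x \<in> V \<and> g V < eexp (- c))"
proof -
  have "c < loc_rate g x \<longleftrightarrow> eexp (- loc_rate g x) < eexp (- c)"
    by simp
  then show ?thesis
    unfolding eexp_minus_loc_rate by (auto simp: INF_less_iff)
qed

lemma loc_rate_le_iff: "loc_rate g x \<le> c \<longleftrightarrow> (\<forall>V. open V \<longrightarrow> x \<in> V \<longrightarrow> eexp (- c) \<le> g V)"
  using less_loc_rate_iff[of c g x] by (auto simp: not_less[symmetric])

text \<open>Chebyshev estimates arrive with a spare factor \<open>exp e\<close>, which disappears as
  \<open>e\<close> tends to \<open>0\<close>.\<close>

lemma le_loc_rateI:
  assumes "\<And>e. 0 < e \<Longrightarrow> \<exists>V. open V \<and> x \<in> V \<and> g V \<le> eexp (- c + ereal e)"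
  shows "c \<le> loc_rate g x"
proof (cases c)
  case (real r)
  show ?thesis
  proof (rule ereal_le_epsilon2)
    fix e :: real assume "0 < e"
    with assms obtain V where V: "open V" "x \<in> V" "g V \<le> eexp (- c + ereal e)" by blast
    have "eexp (- loc_rate g x) \<le> g V"
      unfolding eexp_minus_loc_rate by (rule INF_lower) (use V in auto)
    also note V(3)
    finally have "- loc_rate g x \<le> - c + ereal e" by simp
    then show "c \<le> loc_rate g x + ereal e"
      using real by (cases "loc_rate g x") auto
  qed
next
  case PInf
  \<comment> \<open>Here \<open>- c + ereal 1\<close> is still \<open>-\<infinity>\<close>, so this
    single \<open>e\<close> already forces \<open>g V = 0\<close>.\<close>
  with assms[of 1] obtain V where V: "open V" "x \<in> V" "g V \<le> eexp (- c + ereal 1)" by auto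
  have "eexp (- loc_rate g x) \<le> g V"
    unfolding eexp_minus_loc_rate by (rule INF_lower) (use V in auto)
  also have "\<dots> \<le> eexp (- \<infinity>)" using V(3) PInf by simp
  finally have "- loc_rate g x \<le> - \<infinity>" by (simp only: eexp_le_iff)
  then show ?thesis using PInf by (cases "loc_rate g x") auto
qed auto

text \<open>A neighbourhood witnessing \<open>c < loc_rate g x\<close> does so for each of its
  points, so strict superlevel sets are open.\<close>

lemma lsc_loc_rate: "lsc (loc_rate g)"
proof -
  have "open {x. c < loc_rate g x}" for c
    unfolding less_loc_rate_iff by (subst open_subopen) blast
  moreover have "{x. loc_rate g x \<le> c} = - {x. c < loc_rate g x}" for c
    by auto
  ultimately show ?thesis
    by (simp add: lsc_def closed_def)
qed

section \<open>Proper convex functions on the line\<close>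

text \<open>The domain is the projection of the epigraph; a point of it lifts because its value is
  real.\<close>

lemma proper_convex_Dom:
  fixes f :: "real \<Rightarrow> ereal"
  assumes f: "proper_convex f"
  shows "convex (Dom f)"
proof -
  have cvx: "convex {(x, r :: real). f x \<le> ereal r}" and noMI: "\<And>x. f x \<noteq> -\<infinity>"
    using f by (auto simp: proper_convex_def)
  have fin: "\<exists>r. f z = ereal r" if "z \<in> Dom f" for z
    using that noMI[of z] by (cases "f z") (auto simp: Dom_def)
  have "Dom f = fst ` {(x, r :: real). f x \<le> ereal r}"
  proof safe
    fix z assume "z \<in> Dom f"
    then obtain r where "f z = ereal r" using fin by blast
    then show "z \<in> fst ` {(x, r :: real). f x \<le> ereal r}" by (intro image_eqI[of _ _ "(z, r)"]) auto
  qed (auto simp: Dom_def intro: le_less_trans)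
  then show ?thesis
    using convex_linear_image[OF linear_fst cvx] by simp
qed

text \<open>Move from \<open>x\<close> along the segment towards an interior point \<open>y\<close>.
  Its inner points are interior to the domain, and \<open>f\<close> lies below the chord, which
  tends to \<open>f x\<close>. A strict violation at \<open>x\<close> would persist nearby by lower
  semicontinuity of \<open>g\<close>, against the bound in the interior.\<close>

lemma lsc_le_of_convex_boundary:
  fixes f g :: "real \<Rightarrow> ereal"
  assumes f: "proper_convex f" and g: "lsc g"
    and le: "\<And>y. y \<in> interior (Dom f) \<Longrightarrow> g y \<le> max (f y) m"
    and ne: "interior (Dom f) \<noteq> {}" and x: "x \<in> Dom f"
  shows "g x \<le> max (f x) m"
proof (rule ccontr)
  assume "\<not> g x \<le> max (f x) m"
  then have "max (f x) m < g x" by (simp only: not_le)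
  obtain y where y: "y \<in> interior (Dom f)" using ne by blast
  have cvx: "convex {(x, r :: real). f x \<le> ereal r}" and noMI: "\<And>x. f x \<noteq> -\<infinity>"
    using f by (auto simp: proper_convex_def)
  have fin: "\<exists>r. f z = ereal r" if "z \<in> Dom f" for z
    using that noMI[of z] by (cases "f z") (auto simp: Dom_def)
  obtain r where r: "f x = ereal r" using fin x by blast
  obtain q where q: "f y = ereal q" using fin y interior_subset by blast
  have conv: "f (x - s * (x - y)) \<le> ereal ((1 - s) * r + s * q)" if "0 \<le> s" "s \<le> 1" for s
  proof -
    have "(1 - s) *\<^sub>R (x, r) + s *\<^sub>R (y, q) \<in> {(x, r :: real). f x \<le> ereal r}"
      by (rule convexD[OF cvx]) (use r q that in auto)
    then show ?thesis by (simp add: algebra_simps)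
  qed
  have cD: "convex (Dom f)" by (rule proper_convex_Dom[OF f])
  obtain c where c: "max (f x) m < ereal c" "ereal c < g x"
    using \<open>max (f x) m < g x\<close> ereal_dense2 by blast
  have O: "open (- {z. g z \<le> ereal c})" using g by (simp add: lsc_def open_Compl)
  have "((\<lambda>s. x - s * (x - y)) \<longlongrightarrow> x - 0 * (x - y)) (at_right 0)"
    by (intro tendsto_intros)
  then have "\<forall>\<^sub>F s in at_right 0. x - s * (x - y) \<in> - {z. g z \<le> ereal c}"
    by (rule topological_tendstoD[OF _ O]) (use c in auto)
  moreover have "((\<lambda>s. (1 - s) * r + s * q) \<longlongrightarrow> (1 - 0) * r + 0 * q) (at_right 0)"
    by (intro tendsto_intros)
  then have "\<forall>\<^sub>F s in at_right 0. (1 - s) * r + s * q < c"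
    by (rule order_tendstoD) (use c r in auto)
  moreover have "\<forall>\<^sub>F s :: real in at_right 0. s \<in> {0<..<1}"
    by (rule eventually_at_right_real) auto
  ultimately have "\<forall>\<^sub>F s in at_right 0. (x - s * (x - y) \<in> - {z. g z \<le> ereal c})
      \<and> (1 - s) * r + s * q < c \<and> s \<in> {0<..<1}"
    by eventually_elim blast
  then obtain s where s: "x - s * (x - y) \<in> - {z. g z \<le> ereal c}"
      "(1 - s) * r + s * q < c" "s \<in> {0<..<1}"
    using eventually_happens trivial_limit_at_right_real by fastforce
  have "x - s * (x - y) \<in> interior (Dom f)"
    using mem_interior_convex_shrink[OF cD y x, of s] s by auto
  then have "g (x - s * (x - y)) \<le> max (f (x - s * (x - y))) m" by (rule le)
  also have "\<dots> \<le> ereal c"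
    using conv[of s] s c by (auto intro: order_trans)
  finally show False using s by simp
qed

text \<open>Two distinct points of the domain would enclose an open interval inside it.\<close>

lemma proper_convex_empty_interior:
  assumes f: "proper_convex f" and "interior (Dom f) = {}"
  obtains x where "Dom f = {x}"
proof -
  have cD: "convex (Dom f)" by (rule proper_convex_Dom[OF f])
  have "\<exists>x. \<bar>f x\<bar> \<noteq> \<infinity>" using f by (simp add: proper_convex_def)
  then obtain x where x: "\<bar>f x\<bar> \<noteq> \<infinity>" by (rule exE)
  then have xD: "x \<in> Dom f" by (auto simp: Dom_def)
  have no: False if "a \<in> Dom f" "b \<in> Dom f" "a < b" for a b
  proof -
    have "{a<..<b} \<subseteq> Dom f"
      using closed_segment_subset[OF that(1,2) cD] that(3)
      by (auto simp: closed_segment_eq_real_ivl)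
    then have "{a<..<b} \<subseteq> interior (Dom f)" by (simp add: interior_maximal)
    with assms(2) \<open>a < b\<close> show False by simp
  qed
  have "y = x" if "y \<in> Dom f" for y
    using no[OF that xD] no[OF xD that] by (meson linorder_neqE_linordered_idom)
  then have "Dom f = {x}" using xD by blast
  then show ?thesis using that by blast
qed

section \<open>Secant slopes near a one-sided derivative\<close>

text \<open>Fix \<open>r\<close> first, with secant slope from \<open>a\<close> to \<open>r\<close>
  below \<open>D + d\<close>. As \<open>l\<close> decreases to \<open>a\<close>, continuity carries
  this bound over to the secant from \<open>l\<close> to \<open>r\<close>, while the secant from
  \<open>a\<close> to \<open>l\<close> has slope above \<open>D - d\<close>. The point
  \<open>l\<close> thus has a good secant on each side.\<close>

lemma right_derivative_slopes:
  fixes f :: "real \<Rightarrow> real"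
  assumes D: "(f has_real_derivative D) (at_right a)" and "0 < d" "0 < e"
  obtains l r where "a < l" "l < r" "r < a + e" "\<bar>f l - f a\<bar> < e"
    "f r - f l < (r - l) * (D + d)" "(l - a) * (D - d) < f l - f a"
proof -
  have sl: "((\<lambda>y. (f y - f a) / (y - a)) \<longlongrightarrow> D) (at_right a)"
    using D by (simp add: has_field_derivative_iff)
  have ev: "\<forall>\<^sub>F y in at_right a. y \<in> {a<..<a+e} \<and> (f y - f a) / (y - a) < D + d
      \<and> D - d < (f y - f a) / (y - a)"
    using order_tendstoD[OF sl, of "D + d"] order_tendstoD[OF sl, of "D - d"] assms
      eventually_at_right_real[of a "a+e"] by (auto simp: eventually_conj_iff)
  then obtain r where r: "r \<in> {a<..<a+e}" "(f r - f a) / (r - a) < D + d"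
    using eventually_happens trivial_limit_at_right_real by fastforce
  have ft: "(f \<longlongrightarrow> f a) (at_right a)"
    using DERIV_isCont D has_field_derivative_imp_has_derivative has_derivative_continuous
      continuous_within by blast
  have "((\<lambda>l. f r - f l - (r - l) * (D + d)) \<longlongrightarrow> f r - f a - (r - a) * (D + d)) (at_right a)"
    by (intro tendsto_intros ft)
  moreover have "f r - f a - (r - a) * (D + d) < 0"
    using r by (auto simp: field_simps)
  ultimately have "\<forall>\<^sub>F l in at_right a. f r - f l - (r - l) * (D + d) < 0"
    using order_tendstoD by blast
  moreover have "\<forall>\<^sub>F l in at_right a. l \<in> {a<..<r}"
    by (rule eventually_at_right_real) (use r in auto)
  moreover have "\<forall>\<^sub>F l in at_right a. dist (f l) (f a) < e"
    by (rule tendstoD[OF ft \<open>0 < e\<close>])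
  ultimately have "\<forall>\<^sub>F l in at_right a. f r - f l - (r - l) * (D + d) < 0 \<and> l \<in> {a<..<r} \<and>
      dist (f l) (f a) < e \<and> D - d < (f l - f a) / (l - a)"
    using ev by eventually_elim blast
  then obtain l where l: "f r - f l - (r - l) * (D + d) < 0" "l \<in> {a<..<r}"
      "dist (f l) (f a) < e" "D - d < (f l - f a) / (l - a)"
    using eventually_happens trivial_limit_at_right_real by fastforce
  show ?thesis
    by (rule that[of l r]) (use l r in \<open>auto simp: dist_real_def field_simps\<close>)
qed

text \<open>Reflection: the right-hand version is applied to \<open>f (- s)\<close> at
  \<open>- a\<close>, where the derivative is \<open>- D\<close>.\<close>

lemma left_derivative_slopes:
  fixes f :: "real \<Rightarrow> real"
  assumes D: "(f has_real_derivative D) (at_left a)" and "0 < d" "0 < e"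
  obtains p l where "a - e < p" "p < l" "l < a" "\<bar>f l - f a\<bar> < e"
    "f a - f l < (a - l) * (D + d)" "(l - p) * (D - d) < f l - f p"
proof -
  have "uminus ` {- a<..} = {..<a}" by simp
  then have "(f has_real_derivative D) (at (- (- a)) within uminus ` {- a<..})"
    using D by simp
  then have "(f \<circ> uminus has_real_derivative D * - 1) (at_right (- a))"
    by (rule DERIV_image_chain) (auto intro!: derivative_eq_intros)
  then have "((\<lambda>s. f (- s)) has_real_derivative - D) (at_right (- a))"
    by (simp add: o_def)
  then obtain l r where lr: "- a < l" "l < r" "r < - a + e" "\<bar>f (- l) - f (- (- a))\<bar> < e"
    "f (- r) - f (- l) < (r - l) * (- D + d)" "(l - - a) * (- D - d) < f (- l) - f (- (- a))"
    by (rule right_derivative_slopes[OF _ assms(2,3)])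
  show ?thesis
    by (rule that[of "- r" "- l"]) (use lr in \<open>auto simp: algebra_simps\<close>)
qed

section \<open>Tilted masses along the net\<close>

locale laplace_net =
  fixes F :: "'i filter" and \<mu> :: "'i \<Rightarrow> real measure" and t :: "'i \<Rightarrow> real"
  assumes F: "F \<noteq> bot"
    and subprob: "\<And>i. subprob_space (\<mu> i)"
    and sets_\<mu>: "\<And>i. sets (\<mu> i) = sets borel"
    and t_pos: "\<And>i. 0 < t i"
    and t_lim: "(t \<longlongrightarrow> 0) F"
begin

abbreviation "\<rho>0 \<equiv> ell0 F \<mu> t"
abbreviation "\<rho>1 \<equiv> ell1 F \<mu> t"
abbreviation "m0 \<equiv> - Lam_upper F \<mu> t (\<lambda>_. 0)"

text \<open>For \<open>l = 0\<close> this is the power of the mass of \<open>A\<close>; for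
  \<open>A = UNIV\<close> its limits are the exponentials of the lower and upper
  \<open>\<Lambda>\<close> at \<open>hlin l\<close>.\<close>

definition tilt :: "real \<Rightarrow> real set \<Rightarrow> 'i \<Rightarrow> ennreal" where
  "tilt l A i = epowr (\<integral>\<^sup>+y. ennreal (exp (l * y / t i)) * indicator A y \<partial>\<mu> i) (t i)"

lemma space_\<mu> [simp]: "space (\<mu> i) = UNIV"
  using sets_eq_imp_space_eq[OF sets_\<mu>] by simp

lemma l0_eq: "\<rho>0 = loc_rate (limsup_pow F \<mu> t)" and l1_eq: "\<rho>1 = loc_rate (liminf_pow F \<mu> t)"
  by (simp_all add: fun_eq_iff ell0_def ell1_def loc_rate_def)

lemma epowr_exp_mult: "epowr (ennreal (exp (r / t i)) * u) (t i) = ennreal (exp r) * epowr u (t i)"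
  using t_pos[of i] by (simp add: epowr_mult powr_def)

lemma tilt_zero: "A \<in> sets borel \<Longrightarrow> tilt 0 A i = epowr (emeasure (\<mu> i) A) (t i)"
  by (simp add: tilt_def sets_\<mu>)

lemma limsup_pow_eq_tilt: "A \<in> sets borel \<Longrightarrow> limsup_pow F \<mu> t A = Limsup F (tilt 0 A)"
  unfolding limsup_pow_def by (intro Limsup_eq always_eventually allI tilt_zero[symmetric])

lemma liminf_pow_eq_tilt: "A \<in> sets borel \<Longrightarrow> liminf_pow F \<mu> t A = Liminf F (tilt 0 A)"
  unfolding liminf_pow_def by (intro Liminf_eq always_eventually allI tilt_zero[symmetric])

text \<open>The factor \<open>exp (c / t i)\<close> becomes \<open>exp c\<close>, independent of
  \<open>i\<close>, under the power \<open>t i\<close>. Suitable parameters yield monotonicity in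
  the set, Chebyshev bounds and the return from a tilt to the original measures.\<close>

lemma tilt_le_shift:
  assumes "\<And>y. y \<in> A \<Longrightarrow> l * y \<le> l' * y + c" "A \<subseteq> B" "B \<in> sets borel"
  shows "tilt l A i \<le> ennreal (exp c) * tilt l' B i"
proof -
  have "tilt l A i \<le> epowr (\<integral>\<^sup>+y. ennreal (exp (c / t i)) *
      (ennreal (exp (l' * y / t i)) * indicator B y) \<partial>\<mu> i) (t i)"
    unfolding tilt_def
  proof (intro epowr_mono nn_integral_mono t_pos)
    fix y
    show "ennreal (exp (l * y / t i)) * indicator A y
      \<le> ennreal (exp (c / t i)) * (ennreal (exp (l' * y / t i)) * indicator B y)"
    proof (cases "y \<in> A")
      case True
      then have "l * y / t i \<le> c / t i + l' * y / t i"
        using assms(1)[of y] t_pos[of i] by (simp add: field_simps)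
      then show ?thesis
        using True assms(2) by (auto simp: exp_add[symmetric] simp flip: ennreal_mult)
    qed simp
  qed
  also have "(\<integral>\<^sup>+y. ennreal (exp (c / t i)) *
      (ennreal (exp (l' * y / t i)) * indicator B y) \<partial>\<mu> i)
    = ennreal (exp (c / t i)) * (\<integral>\<^sup>+y. ennreal (exp (l' * y / t i)) * indicator B y \<partial>\<mu> i)"
    using assms(3) by (intro nn_integral_cmult) (simp add: measurable_cong_sets[OF sets_\<mu> refl])
  finally show ?thesis
    unfolding tilt_def epowr_exp_mult .
qed

lemma tilt_mono: "A \<subseteq> B \<Longrightarrow> B \<in> sets borel \<Longrightarrow> tilt l A i \<le> tilt l B i"
  using tilt_le_shift[of A l l 0 B i] by simp

text \<open>The factor \<open>2\<close> in \<open>a + b \<le> 2 max a b\<close> disappears in the limit because \<open>2 powr t i\<close> tends to \<open>1\<close>;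
  at the exponential scale sums therefore behave like maxima.\<close>

lemma eventually_epowr_add_less:
  assumes "K' < K"
  shows "\<forall>\<^sub>F i in F. \<forall>a b. epowr a (t i) \<le> K' \<longrightarrow> epowr b (t i) \<le> K' \<longrightarrow> epowr (a + b) (t i) < K"
proof -
  obtain k where k: "K' = ennreal k" "0 \<le> k"
    using assms by (cases K') auto
  have "((\<lambda>i. ennreal (2 powr t i * k)) \<longlongrightarrow> ennreal (2 powr 0 * k)) F"
    by (intro tendsto_intros t_lim) auto
  then have "\<forall>\<^sub>F i in F. ennreal (2 powr t i * k) < K"
    by (rule order_tendstoD) (use assms k in auto)
  then show ?thesis
  proof eventually_elim
    case (elim i)
    show ?case
    proof (intro allI impI)
      fix a b assume ab: "epowr a (t i) \<le> K'" "epowr b (t i) \<le> K'"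
      have "a + b \<le> ennreal 2 * max a b"
        by (metis add_mono ennreal_numeral max.cobounded1 max.cobounded2 mult_2 zero_le_numeral)
      then have "epowr (a + b) (t i) \<le> ennreal (2 powr t i) * epowr (max a b) (t i)"
        using epowr_mono[OF _ t_pos, of "a + b" "ennreal 2 * max a b" i] epowr_mult[of 2] by simp
      also have "\<dots> \<le> ennreal (2 powr t i) * K'"
        using ab by (intro mult_left_mono) (auto simp: epowr_max[OF t_pos])
      also have "\<dots> < K" using elim k by (simp add: ennreal_mult)
      finally show "epowr (a + b) (t i) < K" .
    qed
  qed
qed

text \<open>The two integrals are hidden behind \<open>a\<close> and \<open>b\<close>, the shape
  that \<open>eventually_epowr_add_less\<close> handles.\<close>

lemma tilt_Un_le:
  assumes "A \<in> sets borel" "B \<in> sets borel"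
  shows "\<exists>a b. tilt l A i = epowr a (t i) \<and> tilt l B i = epowr b (t i) \<and>
    tilt l (A \<union> B) i \<le> epowr (a + b) (t i)"
proof -
  show ?thesis
    unfolding tilt_def
  proof (intro exI conjI, rule refl, rule refl, intro epowr_mono t_pos)
    show "(\<integral>\<^sup>+y\<in>A \<union> B. ennreal (exp (l * y / t i))\<partial>\<mu> i)
      \<le> (\<integral>\<^sup>+y\<in>A. ennreal (exp (l * y / t i))\<partial>\<mu> i) + (\<integral>\<^sup>+y\<in>B. ennreal (exp (l * y / t i))\<partial>\<mu> i)"
      using assms by (subst nn_integral_add[symmetric])
        (auto intro!: nn_integral_mono simp: indicator_def measurable_cong_sets[OF sets_\<mu> refl])
  qed
qed

lemma Limsup_tilt_Un:
  assumes "A \<in> sets borel" "B \<in> sets borel"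
  shows "Limsup F (tilt l (A \<union> B)) \<le> max (Limsup F (tilt l A)) (Limsup F (tilt l B))"
  unfolding Limsup_le_iff
proof (intro allI impI)
  fix K assume "max (Limsup F (tilt l A)) (Limsup F (tilt l B)) < K"
  then obtain K' where K': "max (Limsup F (tilt l A)) (Limsup F (tilt l B)) < K'" "K' < K"
    using dense by blast
  have "\<forall>\<^sub>F i in F. tilt l A i < K'" "\<forall>\<^sub>F i in F. tilt l B i < K'"
    using K' by (auto intro: Limsup_lessD)
  with eventually_epowr_add_less[OF K'(2)]
  show "\<forall>\<^sub>F i in F. tilt l (A \<union> B) i < K"
  proof eventually_elim
    case (elim i)
    then show ?case using tilt_Un_le[OF assms, of l i]
      by (metis le_less_trans less_imp_le)
  qed
qed

text \<open>If the tilt on \<open>A\<close> were as small as that on \<open>B\<close>, the two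
  together would fall short of what the union carries. Mass missing from a negligible
  \<open>B\<close> therefore lies in \<open>A\<close>.\<close>

lemma le_Liminf_tilt:
  assumes "A \<in> sets borel" "B \<in> sets borel"
    and "E \<le> Liminf F (tilt l (A \<union> B))" "Limsup F (tilt l B) < E"
  shows "E \<le> Liminf F (tilt l A)"
  unfolding le_Liminf_iff
proof (intro allI impI)
  fix y assume "y < E"
  then obtain K where K: "max y (Limsup F (tilt l B)) < K" "K < E"
    using assms(4) dense[of "max y (Limsup F (tilt l B))" E] by auto
  \<comment> \<open>The gap between \<open>K'\<close> and \<open>K\<close> absorbs the factor
    \<open>2 powr t i\<close> of a sum.\<close>
  then obtain K' where K': "max y (Limsup F (tilt l B)) < K'" "K' < K"
    using dense by blast
  have "\<forall>\<^sub>F i in F. tilt l B i < K'"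
    using K' by (auto intro: Limsup_lessD)
  moreover have "\<forall>\<^sub>F i in F. K < tilt l (A \<union> B) i"
    using K(2) assms(3) by (auto simp: le_Liminf_iff)
  ultimately show "\<forall>\<^sub>F i in F. y < tilt l A i"
    using eventually_epowr_add_less[OF K'(2)]
  proof eventually_elim
    case (elim i)
    obtain a b where ab: "tilt l A i = epowr a (t i)" "tilt l B i = epowr b (t i)"
      "tilt l (A \<union> B) i \<le> epowr (a + b) (t i)" using tilt_Un_le[OF assms(1,2), of l i] by blast
    have "\<not> tilt l A i \<le> K'"
    proof
      assume "tilt l A i \<le> K'"
      then have "epowr (a + b) (t i) < K" using elim ab by auto
      with elim ab show False by auto
    qed
    then show ?case using K' by auto
  qed
qed

lemma Limsup_tilt_mono: "A \<subseteq> B \<Longrightarrow> B \<in> sets borel \<Longrightarrow> B \<in> sets borel \<Longrightarrow> Limsup F (tilt l A) \<le> Limsup F (tilt l B)"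
  by (intro Limsup_mono always_eventually allI tilt_mono)

lemma Limsup_tilt_le_shift:
  assumes "\<And>y. y \<in> A \<Longrightarrow> l * y \<le> l' * y + c" "A \<subseteq> B" "B \<in> sets borel"
  shows "Limsup F (tilt l A) \<le> ennreal (exp c) * Limsup F (tilt l' B)"
proof -
  have "Limsup F (tilt l A) \<le> Limsup F (\<lambda>i. ennreal (exp c) * tilt l' B i)"
    by (intro Limsup_mono always_eventually allI tilt_le_shift) (use assms in auto)
  then show ?thesis by (simp add: Limsup_cmult_ennreal[OF F])
qed

lemma Liminf_tilt_le_shift:
  assumes "\<And>y. y \<in> A \<Longrightarrow> l * y \<le> l' * y + c" "A \<subseteq> B" "B \<in> sets borel"
  shows "Liminf F (tilt l A) \<le> ennreal (exp c) * Liminf F (tilt l' B)"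
proof -
  have "Liminf F (tilt l A) \<le> Liminf F (\<lambda>i. ennreal (exp c) * tilt l' B i)"
    by (intro Liminf_mono always_eventually allI tilt_le_shift) (use assms in auto)
  then show ?thesis by (simp add: Liminf_cmult_ennreal[OF F])
qed

section \<open>Elementary bounds for the two rates\<close>

lemma limsup_pow_Un:
  assumes "A \<in> sets borel" "B \<in> sets borel"
  shows "limsup_pow F \<mu> t (A \<union> B) \<le> max (limsup_pow F \<mu> t A) (limsup_pow F \<mu> t B)"
  using assms Limsup_tilt_Un[OF assms, of 0] by (simp add: limsup_pow_eq_tilt)

lemma liminf_le_limsup_pow: "liminf_pow F \<mu> t A \<le> limsup_pow F \<mu> t A"
  unfolding liminf_pow_def limsup_pow_def by (rule Liminf_le_Limsup[OF F])

lemma limsup_pow_mono: "A \<subseteq> B \<Longrightarrow> B \<in> sets borel \<Longrightarrow> limsup_pow F \<mu> t A \<le> limsup_pow F \<mu> t B"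
  unfolding limsup_pow_def
  by (intro Limsup_mono always_eventually allI epowr_mono t_pos emeasure_mono) (auto simp: sets_\<mu>)

lemma limsup_pow_empty [simp]: "limsup_pow F \<mu> t {} = 0"
  by (simp add: limsup_pow_def Limsup_const[OF F])

lemma Lam_lower_hlin: "Lam_lower F \<mu> t (hlin l) = elog (Liminf F (tilt l UNIV))"
  and Lam_upper_hlin: "Lam_upper F \<mu> t (hlin l) = elog (Limsup F (tilt l UNIV))"
proof -
  have "ereal (l * x) / ereal (t i) = ereal (l * x / t i)" for x i
    using t_pos[of i] by simp
  then show "Lam_lower F \<mu> t (hlin l) = elog (Liminf F (tilt l UNIV))"
    "Lam_upper F \<mu> t (hlin l) = elog (Limsup F (tilt l UNIV))"
    unfolding Lam_lower_def Lam_upper_def hlin_def tilt_def[abs_def] by simp_all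
qed

lemma hlin_zero: "hlin 0 = (\<lambda>_. 0)"
  by (simp add: hlin_def fun_eq_iff zero_ereal_def)

lemma eexp_minus_m: "eexp (- m0) = limsup_pow F \<mu> t UNIV"
  using Lam_upper_hlin[of 0] by (simp add: hlin_zero limsup_pow_eq_tilt)

text \<open>Sub-probability masses are at most \<open>1\<close>, and so are their powers.\<close>

lemma m_nonneg: "0 \<le> m0"
proof -
  have "epowr (emeasure (\<mu> i) UNIV) (t i) \<le> 1" for i
  proof -
    have "emeasure (\<mu> i) UNIV \<le> 1"
      using subprob_space.subprob_emeasure_le_1[OF subprob] .
    then show ?thesis
      using epowr_mono[OF _ t_pos, of _ 1 i] by (fastforce simp: epowr_def)
  qed
  then have "limsup_pow F \<mu> t UNIV \<le> 1"
    unfolding limsup_pow_def by (intro Limsup_bounded always_eventually allI)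
  then have "eexp (- m0) \<le> eexp 0"
    unfolding eexp_minus_m by (simp add: zero_ereal_def)
  then show ?thesis by (simp del: ereal_uminus_uminus)
qed

text \<open>The whole line is one of the neighbourhoods of \<open>x\<close>.\<close>

lemma m_le_l0: "m0 \<le> \<rho>0 x"
proof -
  have "limsup_pow F \<mu> t UNIV \<ge> eexp (- \<rho>0 x)"
    unfolding l0_eq eexp_minus_loc_rate by (rule INF_lower) auto
  then show ?thesis
    unfolding eexp_minus_m[symmetric] by (simp del: ereal_uminus_uminus)
qed

lemma l0_le_l1: "\<rho>0 x \<le> \<rho>1 x"
proof -
  have "eexp (- \<rho>1 x) \<le> eexp (- \<rho>0 x)"
    unfolding l0_eq l1_eq eexp_minus_loc_rate by (rule INF_mono) (use liminf_le_limsup_pow in blast)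
  then show ?thesis by simp
qed

section \<open>Compact upper bound and the vague principle\<close>

text \<open>Finitely many open sets with limsup below \<open>y\<close> cover \<open>K\<close>, and
  finite unions behave like maxima.\<close>

lemma limsup_pow_compact_le:
  assumes K: "compact K" and M: "\<And>x. x \<in> K \<Longrightarrow> eexp (- \<rho>0 x) \<le> M"
  shows "limsup_pow F \<mu> t K \<le> M"
proof (rule dense_ge)
  fix y assume "M < y"
  have "\<exists>V. open V \<and> x \<in> V \<and> limsup_pow F \<mu> t V < y" if "x \<in> K" for x
  proof -
    have "(INF V\<in>{V. open V \<and> x \<in> V}. limsup_pow F \<mu> t V) < y"
      using le_less_trans[OF M[OF that] \<open>M < y\<close>] by (simp only: l0_eq eexp_minus_loc_rate)
    then show ?thesis unfolding INF_less_iff by blast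
  qed
  then obtain V where V: "\<And>x. x \<in> K \<Longrightarrow> open (V x) \<and> x \<in> V x \<and> limsup_pow F \<mu> t (V x) < y"
    by metis
  have "\<And>x. x \<in> K \<Longrightarrow> open (V x)" "K \<subseteq> (\<Union>c\<in>K. V c)"
    using V by auto
  then obtain C where C: "C \<subseteq> K" "finite C" "K \<subseteq> (\<Union>c\<in>C. V c)"
    by (rule compactE_image[OF K])
  have "limsup_pow F \<mu> t (\<Union>c\<in>C. V c) \<le> y"
    using C(2,1)
  proof (induction C)
    case (insert c C)
    then have "c \<in> K" "C \<subseteq> K" by auto
    then have "open (V c)" "open (\<Union>c\<in>C. V c)" using V by (auto intro!: open_UN)
    then have "limsup_pow F \<mu> t (V c \<union> (\<Union>c\<in>C. V c))
        \<le> max (limsup_pow F \<mu> t (V c)) (limsup_pow F \<mu> t (\<Union>c\<in>C. V c))"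
      by (intro limsup_pow_Un borel_open)
    also have "\<dots> \<le> y"
      using V[OF \<open>c \<in> K\<close>] insert.IH[OF \<open>C \<subseteq> K\<close>] by (simp add: less_imp_le)
    finally show ?case by simp
  qed simp
  moreover have "(\<Union>c\<in>C. V c) \<in> sets borel" using V C(1) by (intro borel_open open_UN) blast
  ultimately show "limsup_pow F \<mu> t K \<le> y"
    using limsup_pow_mono[OF C(3)] by (meson order_trans)
qed

text \<open>Upper bounds on compact sets come from \<open>\<rho>0\<close>, lower bounds on open sets
  from \<open>\<rho>1\<close>.\<close>

lemma vague_ldp_l0:
  assumes "\<rho>0 = \<rho>1"
  shows "vague_ldp F \<mu> t \<rho>0"
  unfolding vague_ldp_def
proof (intro conjI allI impI)
  show "0 \<le> \<rho>0 x" for x using m_nonneg m_le_l0 order_trans by blast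
  show "lsc \<rho>0" unfolding l0_eq by (rule lsc_loc_rate)
  show "limsup_pow F \<mu> t K \<le> (SUP x\<in>K. eexp (- \<rho>0 x))" if "compact K" for K
    by (rule limsup_pow_compact_le[OF that]) (rule SUP_upper)
  show "(SUP x\<in>V. eexp (- \<rho>0 x)) \<le> liminf_pow F \<mu> t V" if "open V" for V
    unfolding assms unfolding l1_eq eexp_minus_loc_rate
    by (rule SUP_least, rule INF_lower) (use that in auto)
qed

section \<open>Legendre-Fenchel transforms as lower bounds for the rate\<close>

text \<open>Chebyshev's inequality on the set where \<open>h\<close> exceeds \<open>h x - e\<close>,
  which is a neighbourhood of \<open>x\<close> by continuity.\<close>

lemma ediff_Lam_le_l0:
  assumes cont: "continuous_on UNIV h" and fin: "\<And>y. h y < \<infinity>"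
  shows "ediff (h x) (Lam F \<mu> t h) \<le> \<rho>0 x"
proof (cases "h x")
  case (real a)
  have "a - Lam F \<mu> t h \<le> \<rho>0 x"
    unfolding l0_eq
  proof (rule le_loc_rateI)
    fix e :: real assume "0 < e"
    let ?V = "{y. ereal (a - e) < h y}"
    have "open (h -` {ereal (a - e)<..})"
      by (rule open_vimage[OF open_greaterThan cont])
    then have V: "open ?V" by (simp add: vimage_def greaterThan_def)
    have "ennreal (exp (a - e)) * limsup_pow F \<mu> t ?V
      = Limsup F (\<lambda>i. epowr (ennreal (exp ((a - e) / t i)) * emeasure (\<mu> i) ?V) (t i))"
      by (simp add: limsup_pow_def epowr_exp_mult Limsup_cmult_ennreal[OF F])
    also have "\<dots> \<le> Limsup F (\<lambda>i. epowr (\<integral>\<^sup>+ x. eexp (h x / ereal (t i)) \<partial>\<mu> i) (t i))"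
    proof (intro Limsup_mono always_eventually allI epowr_mono t_pos)
      fix i
      have "ennreal (exp ((a - e) / t i)) * emeasure (\<mu> i) ?V
        = (\<integral>\<^sup>+ x. ennreal (exp ((a - e) / t i)) * indicator ?V x \<partial>\<mu> i)"
        using V by (simp add: nn_integral_cmult_indicator sets_\<mu>)
      also have "\<dots> \<le> (\<integral>\<^sup>+ x. eexp (h x / ereal (t i)) \<partial>\<mu> i)"
      proof (rule nn_integral_mono)
        fix y
        have "ereal ((a - e) / t i) \<le> h y / ereal (t i)" if "y \<in> ?V"
          using that t_pos[of i] fin[of y]
          by (cases "h y") (auto intro: divide_right_mono)
        then show "ennreal (exp ((a - e) / t i)) * indicator ?V y \<le> eexp (h y / ereal (t i))"
          by (auto simp: indicator_def simp flip: eexp_simps(3))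
      qed
      finally show "ennreal (exp ((a - e) / t i)) * emeasure (\<mu> i) ?V
        \<le> (\<integral>\<^sup>+ x. eexp (h x / ereal (t i)) \<partial>\<mu> i)" .
    qed
    also have "\<dots> = eexp (Lam F \<mu> t h)" by (simp add: Lam_def Lam_upper_def)
    finally have *: "ennreal (exp (a - e)) * limsup_pow F \<mu> t ?V \<le> eexp (Lam F \<mu> t h)" .
    have "limsup_pow F \<mu> t ?V = ennreal (exp (e - a)) * (ennreal (exp (a - e)) * limsup_pow F \<mu> t ?V)"
      by (simp add: mult.assoc[symmetric] exp_add[symmetric] flip: ennreal_mult)
    also have "\<dots> \<le> ennreal (exp (e - a)) * eexp (Lam F \<mu> t h)"
      using * by (rule mult_left_mono) simp
    also have "\<dots> = eexp (- (a - Lam F \<mu> t h) + ereal e)"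
      by (cases "Lam F \<mu> t h") (auto simp: ennreal_mult_top exp_add[symmetric] simp flip: ennreal_mult)
    finally show "\<exists>V. open V \<and> x \<in> V \<and> limsup_pow F \<mu> t V \<le> eexp (- (a - Lam F \<mu> t h) + ereal e)"
      using V real \<open>0 < e\<close> by (intro exI[of _ ?V]) auto
  qed
  then show ?thesis using real by (simp add: ediff_def)
next
  \<comment> \<open>The convention in \<open>ediff\<close> makes the left side
    \<open>-\<infinity>\<close> even when \<open>Lam F \<mu> t h = -\<infinity>\<close>.\<close>
  case MInf
  then show ?thesis by (cases "Lam F \<mu> t h") (auto simp: ediff_def)
qed (use fin[of x] in auto)

lemma Lam_star_le_l0:
  assumes "\<And>h. h \<in> S \<Longrightarrow> continuous_on UNIV h \<and> (\<forall>x. h x < \<infinity>)"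
  shows "Lam_star F \<mu> t S x \<le> \<rho>0 x"
  unfolding Lam_star_def by (rule SUP_least, rule ediff_Lam_le_l0) (use assms in auto)

lemma L_star_le_Lam_star:
  assumes "hlin ` G \<subseteq> S"
  shows "L_star F \<mu> t G x \<le> Lam_star F \<mu> t S x"
  unfolding L_star_def Lam_star_def
proof (rule SUP_least)
  fix l assume "l \<in> G"
  then have "ediff (hlin l x) (Lam F \<mu> t (hlin l)) \<le> (SUP h\<in>S. ediff (h x) (Lam F \<mu> t h))"
    using assms by (intro SUP_upper) auto
  then show "ereal (l * x) - Lfun F \<mu> t l \<le> (SUP h\<in>S. ediff (h x) (Lam F \<mu> t h))"
    by (simp add: ediff_def Lfun_def hlin_def[abs_def])
qed

end

section \<open>Tilting by linear functions\<close>

locale laplace_net_line = laplace_net +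
  fixes G :: "real set"
  assumes open_G: "open G"
    and Lam_ex: "\<And>l. l \<in> G \<Longrightarrow> Lam_exists F \<mu> t (hlin l)"
    and Lfun_fin: "\<And>l. l \<in> G \<Longrightarrow> \<bar>Lfun F \<mu> t l\<bar> \<noteq> \<infinity>"
begin

abbreviation "L l \<equiv> real_of_ereal (Lfun F \<mu> t l)"
abbreviation "Lstar \<equiv> L_star F \<mu> t G"

lemma
  assumes "l \<in> G"
  shows Limsup_tilt_UNIV: "Limsup F (tilt l UNIV) = ennreal (exp (L l))"
    and Liminf_tilt_UNIV: "Liminf F (tilt l UNIV) = ennreal (exp (L l))"
proof -
  have up: "elog (Limsup F (tilt l UNIV)) = ereal (L l)"
    using Lfun_fin[OF assms] by (simp add: Lfun_def Lam_def Lam_upper_hlin ereal_real')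
  then show "Limsup F (tilt l UNIV) = ennreal (exp (L l))"
    by (metis eexp_elog eexp_simps(3))
  have "elog (Liminf F (tilt l UNIV)) = ereal (L l)"
    using Lam_ex[OF assms] up by (simp add: Lam_exists_def Lam_upper_hlin Lam_lower_hlin)
  then show "Liminf F (tilt l UNIV) = ennreal (exp (L l))"
    by (metis eexp_elog eexp_simps(3))
qed

lemma le_L_star:
  assumes "l \<in> G"
  shows "ereal (l * x - L l) \<le> Lstar x"
proof -
  have "ereal (l * x) - Lfun F \<mu> t l \<le> Lstar x"
    unfolding L_star_def by (rule SUP_upper[OF assms])
  then show ?thesis
    using Lfun_fin[OF assms] by (cases "Lfun F \<mu> t l") auto
qed

text \<open>The term \<open>l = 0\<close> of the supremum is exactly \<open>m0\<close>.\<close>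

lemma m_le_L_star:
  assumes "0 \<in> G"
  shows "m0 \<le> Lstar x"
proof -
  have "m0 = - Lfun F \<mu> t 0" by (simp add: Lfun_def Lam_def hlin_zero)
  then show ?thesis
    using le_L_star[OF assms, of x] Lfun_fin[OF assms] by (cases "Lfun F \<mu> t 0") auto
qed

lemma chebyshev_tilt:
  assumes "l' \<in> G" "\<And>y. y \<in> A \<Longrightarrow> l * y \<le> l' * y + c"
  shows "Limsup F (tilt l A) \<le> ennreal (exp (c + L l'))"
  using Limsup_tilt_le_shift[OF assms(2), of A UNIV] Limsup_tilt_UNIV[OF assms(1)]
  by (simp add: exp_add ennreal_mult)

text \<open>The complement of \<open>V\<close> is negligible under the tilt, so \<open>V\<close>
  carries all of \<open>exp (L l)\<close>. Removing the tilt on \<open>V\<close> costs at most the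
  factor \<open>exp c\<close>.\<close>

lemma liminf_pow_window:
  assumes l: "l \<in> G" and V: "V \<in> sets borel" and c: "\<And>y. y \<in> V \<Longrightarrow> l * y \<le> c"
    and less: "Limsup F (tilt l (- V)) < ennreal (exp (L l))"
  shows "ennreal (exp (L l - c)) \<le> liminf_pow F \<mu> t V"
proof -
  have "ennreal (exp (L l)) \<le> Liminf F (tilt l V)"
    by (rule le_Liminf_tilt[OF V _ _ less]) (use V Liminf_tilt_UNIV[OF l] in auto)
  also have "\<dots> \<le> ennreal (exp c) * Liminf F (tilt 0 V)"
    by (rule Liminf_tilt_le_shift) (use c V in auto)
  also have "\<dots> = ennreal (exp c) * liminf_pow F \<mu> t V"
    by (simp add: liminf_pow_eq_tilt[OF V])
  finally have "ennreal (exp (- c)) * ennreal (exp (L l))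
      \<le> ennreal (exp (- c)) * (ennreal (exp c) * liminf_pow F \<mu> t V)"
    by (rule mult_left_mono) simp
  then show ?thesis
    by (simp add: mult.assoc[symmetric] exp_add[symmetric] flip: ennreal_mult)
qed

text \<open>The tilt may change with the window. On a window of half-width \<open>d\<close> the
  exponent \<open>l * y\<close> exceeds \<open>l * x\<close> by at most
  \<open>\<bar>l\<bar> * d\<close>, and the last condition charges this to \<open>e\<close>.\<close>

lemma l1_leI:
  assumes "\<And>e. 0 < e \<Longrightarrow> \<exists>d l. 0 < d \<and> d \<le> e \<and> l \<in> G \<and>
    Limsup F (tilt l (- {x - d<..<x + d})) < ennreal (exp (L l)) \<and>
    l * x + \<bar>l\<bar> * d - L l \<le> c + e"
  shows "\<rho>1 x \<le> ereal c"
proof (rule ereal_le_epsilon2)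
  fix e :: real assume "0 < e"
  show "\<rho>1 x \<le> ereal c + ereal e"
    unfolding l1_eq loc_rate_le_iff
  proof (intro allI impI)
    fix V :: "real set" assume V: "open V" "x \<in> V"
    then obtain r where r: "0 < r" "ball x r \<subseteq> V" by (auto simp: open_contains_ball)
    have "0 < min r e" using r \<open>0 < e\<close> by simp
    from assms[OF this] obtain d l where d: "0 < d" "d \<le> min r e" "l \<in> G"
      "Limsup F (tilt l (- {x - d<..<x + d})) < ennreal (exp (L l))"
      "l * x + \<bar>l\<bar> * d - L l \<le> c + min r e" by blast
    have "l * y \<le> l * x + \<bar>l\<bar> * d" if "y \<in> {x - d<..<x + d}" for y
    proof -
      have "l * (y - x) \<le> \<bar>l\<bar> * \<bar>y - x\<bar>" by (metis abs_ge_self abs_mult)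
      also have "\<dots> \<le> \<bar>l\<bar> * d" using that by (intro mult_left_mono) auto
      finally show ?thesis by (simp add: algebra_simps)
    qed
    from liminf_pow_window[OF d(3) _ this d(4)]
    have "ennreal (exp (L l - (l * x + \<bar>l\<bar> * d))) \<le> liminf_pow F \<mu> t {x - d<..<x + d}"
      by simp
    moreover have "ennreal (exp (- (c + e))) \<le> ennreal (exp (L l - (l * x + \<bar>l\<bar> * d)))"
      using d(5) by (intro ennreal_leI) simp
    moreover have "{x - d<..<x + d} \<subseteq> V"
      using r d(2) by (auto simp: ball_eq_greaterThanLessThan)
    then have "liminf_pow F \<mu> t {x - d<..<x + d} \<le> liminf_pow F \<mu> t V"
      unfolding liminf_pow_def using V(1)
      by (intro Liminf_mono always_eventually allI epowr_mono t_pos emeasure_mono) (auto simp: sets_\<mu>)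
    ultimately have "ennreal (exp (- (c + e))) \<le> liminf_pow F \<mu> t V"
      by (meson order_trans)
    then show "eexp (- (ereal c + ereal e)) \<le> liminf_pow F \<mu> t V"
      by simp
  qed
qed

text \<open>Chebyshev with the larger parameter \<open>q\<close> on the right tail and the smaller
  \<open>p\<close> on the left one; the slope conditions put both bounds below
  \<open>exp (L l)\<close>.\<close>

lemma Limsup_tilt_outside_less:
  assumes G: "p \<in> G" "q \<in> G" and ord: "p \<le> l" "l \<le> q"
    and q: "L q - L l < (q - l) * b" and p: "(l - p) * a < L l - L p"
  shows "Limsup F (tilt l (- {a<..<b})) < ennreal (exp (L l))"
proof -
  have "Limsup F (tilt l {b..}) \<le> ennreal (exp (- ((q - l) * b) + L q))"
  proof (rule chebyshev_tilt[OF G(2)])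
    fix y assume "y \<in> {b..}"
    then have "(q - l) * b \<le> (q - l) * y" using ord by (intro mult_left_mono) auto
    then show "l * y \<le> q * y + - ((q - l) * b)" by (simp add: algebra_simps)
  qed
  also have "\<dots> < ennreal (exp (L l))" using q by (intro ennreal_lessI) auto
  finally have 1: "Limsup F (tilt l {b..}) < ennreal (exp (L l))" .
  have "Limsup F (tilt l {..a}) \<le> ennreal (exp ((l - p) * a + L p))"
  proof (rule chebyshev_tilt[OF G(1)])
    fix y assume "y \<in> {..a}"
    then have "(l - p) * y \<le> (l - p) * a" using ord by (intro mult_left_mono) auto
    then show "l * y \<le> p * y + (l - p) * a" by (simp add: algebra_simps)
  qed
  also have "\<dots> < ennreal (exp (L l))" using p by (intro ennreal_lessI) auto
  finally have 2: "Limsup F (tilt l {..a}) < ennreal (exp (L l))" .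
  have "- {a<..<b} = {..a} \<union> {b..}" by auto
  then show ?thesis
    using Limsup_tilt_Un[of "{..a}" "{b..}" l] 1 2 by (simp add: le_less_trans)
qed

text \<open>The tilting parameter is \<open>l\<close>, not \<open>a\<close>: with a one-sided derivative at \<open>a\<close>, tilting at \<open>a\<close> itself
  controls only one of the two tails.\<close>

lemma l1_le_of_slopes:
  assumes a: "a \<in> G"
    and slopes: "\<And>d e. 0 < d \<Longrightarrow> 0 < e \<Longrightarrow> \<exists>p l q. a - e < p \<and> p \<le> l \<and> l \<le> q \<and> q < a + e \<and>
      \<bar>L l - L a\<bar> < e \<and> L q - L l < (q - l) * (x + d) \<and> (l - p) * (x - d) < L l - L p"
  shows "\<rho>1 x \<le> ereal (a * x - L a)"
proof (rule l1_leI)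
  fix e :: real assume e: "0 < e"
  obtain r where r: "0 < r" "ball a r \<subseteq> G" using open_G a by (auto simp: open_contains_ball)
  \<comment> \<open>Three errors of at most \<open>e / 4\<close> each are arranged:
    \<open>\<bar>l\<bar> * d\<close>, the change of \<open>L\<close> from \<open>a\<close> to
    \<open>l\<close>, and \<open>(l - a) * x\<close>. The bounds \<open>r\<close> and
    \<open>1\<close> on \<open>\<eta>\<close> keep \<open>p\<close>, \<open>l\<close>,
    \<open>q\<close> in \<open>G\<close> and \<open>\<bar>l\<bar>\<close> below
    \<open>\<bar>a\<bar> + 1\<close>.\<close>
  define d where "d = min e (e / (4 * (\<bar>a\<bar> + 1)))"
  define \<eta> where "\<eta> = min (min r 1) (min (e / 4) (e / (4 * (\<bar>x\<bar> + 1))))"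
  have "d \<le> e / (4 * (\<bar>a\<bar> + 1))" by (simp add: d_def)
  then have d: "0 < d" "d \<le> e" "(\<bar>a\<bar> + 1) * d \<le> e / 4"
    using e by (simp_all add: d_def field_simps)
  have \<eta>: "0 < \<eta>" "\<eta> \<le> r" "\<eta> \<le> 1" "\<eta> \<le> e / 4"
    using e r unfolding \<eta>_def by (simp_all only: min.coboundedI1 min.coboundedI2 order_refl) (simp add: min_def)
  have "\<eta> \<le> e / (4 * (\<bar>x\<bar> + 1))" by (simp add: \<eta>_def)
  then have \<eta>x: "\<eta> * \<bar>x\<bar> \<le> e / 4" using \<eta>(1) by (simp add: field_simps)
  obtain p l q where plq: "a - \<eta> < p" "p \<le> l" "l \<le> q" "q < a + \<eta>" "\<bar>L l - L a\<bar> < \<eta>"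
    "L q - L l < (q - l) * (x + d)" "(l - p) * (x - d) < L l - L p"
    using slopes[OF d(1) \<eta>(1)] by blast
  have "{p, l, q} \<subseteq> ball a r" using plq \<eta> by (auto simp: dist_real_def)
  then have G: "p \<in> G" "l \<in> G" "q \<in> G" using r by auto
  have "(l - a) * x \<le> \<bar>l - a\<bar> * \<bar>x\<bar>" by (metis abs_ge_self abs_mult)
  also have "\<dots> \<le> \<eta> * \<bar>x\<bar>" using plq by (intro mult_right_mono) auto
  finally have "(l - a) * x \<le> e / 4" using \<eta>x by simp
  moreover have "\<bar>l\<bar> * d \<le> (\<bar>a\<bar> + 1) * d" using plq \<eta> d by (intro mult_right_mono) auto
  ultimately have "l * x + \<bar>l\<bar> * d - L l \<le> a * x - L a + e"
    using d \<eta> plq(5) e by (simp add: algebra_simps)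
  then show "\<exists>d l. 0 < d \<and> d \<le> e \<and> l \<in> G \<and>
    Limsup F (tilt l (- {x - d<..<x + d})) < ennreal (exp (L l)) \<and>
    l * x + \<bar>l\<bar> * d - L l \<le> a * x - L a + e"
    using Limsup_tilt_outside_less[OF G(1,3) plq(2,3,6,7)] G d by blast
qed

lemma l1_le_L_star_slopes:
  assumes "x \<in> slopes F \<mu> t G"
  shows "\<rho>1 x \<le> Lstar x"
proof -
  have "\<exists>a\<in>G. \<rho>1 x \<le> ereal (a * x - L a)"
    using assms unfolding slopes_def
  proof
    assume "x \<in> ran_left_deriv L G"
    then obtain a where a: "a \<in> G" "(L has_real_derivative x) (at_left a)"
      by (auto simp: ran_left_deriv_def)
    have "\<rho>1 x \<le> ereal (a * x - L a)"
    proof (rule l1_le_of_slopes[OF a(1)])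
      fix d e :: real assume de: "0 < d" "0 < e"
      from a(2) de obtain p l where "a - e < p" "p < l" "l < a" "\<bar>L l - L a\<bar> < e"
        "L a - L l < (a - l) * (x + d)" "(l - p) * (x - d) < L l - L p"
        by (rule left_derivative_slopes)
      then show "\<exists>p l q. a - e < p \<and> p \<le> l \<and> l \<le> q \<and> q < a + e \<and>
          \<bar>L l - L a\<bar> < e \<and> L q - L l < (q - l) * (x + d) \<and> (l - p) * (x - d) < L l - L p"
        \<comment> \<open>For a left derivative the upper comparison parameter is \<open>a\<close>
          itself.\<close>
        using de by (intro exI[of _ p] exI[of _ l] exI[of _ a]) auto
    qed
    with a show ?thesis by blast
  next
    assume "x \<in> ran_right_deriv L G"
    then obtain a where a: "a \<in> G" "(L has_real_derivative x) (at_right a)"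
      by (auto simp: ran_right_deriv_def)
    have "\<rho>1 x \<le> ereal (a * x - L a)"
    proof (rule l1_le_of_slopes[OF a(1)])
      fix d e :: real assume de: "0 < d" "0 < e"
      from a(2) de obtain l q where "a < l" "l < q" "q < a + e" "\<bar>L l - L a\<bar> < e"
        "L q - L l < (q - l) * (x + d)" "(l - a) * (x - d) < L l - L a"
        by (rule right_derivative_slopes)
      then show "\<exists>p l q. a - e < p \<and> p \<le> l \<and> l \<le> q \<and> q < a + e \<and>
          \<bar>L l - L a\<bar> < e \<and> L q - L l < (q - l) * (x + d) \<and> (l - p) * (x - d) < L l - L p"
        \<comment> \<open>For a right derivative \<open>a\<close> serves as the lower comparison
          parameter.\<close>
        using de by (intro exI[of _ a] exI[of _ l] exI[of _ q]) auto
    qed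
    with a show ?thesis by blast
  qed
  then show ?thesis using le_L_star order_trans by blast
qed

section \<open>Exponential tightness and the narrow principle\<close>

text \<open>As \<open>G\<close> is open it contains \<open>l + s\<close> and \<open>l - s\<close>
  for some \<open>s > 0\<close>, and Chebyshev with these makes the tails decay like
  \<open>exp (- (s * M))\<close>. The case \<open>l = 0\<close> is exponential tightness of the
  measures.\<close>

lemma Limsup_tilt_tails_le:
  assumes "l \<in> G"
  obtains M where "0 \<le> M" "Limsup F (tilt l ({..- M} \<union> {M..})) \<le> ennreal (exp z)"
proof -
  obtain r where r: "0 < r" "ball l r \<subseteq> G" using open_G assms by (auto simp: open_contains_ball)
  define s where "s = r / 2"
  have s: "0 < s" "l + s \<in> G" "l - s \<in> G"
    using r by (auto simp: s_def dist_real_def intro!: subsetD[OF r(2)])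
  \<comment> \<open>Solves \<open>L (l + s) - s * M \<le> z\<close> and
    \<open>L (l - s) - s * M \<le> z\<close> for \<open>M\<close>.\<close>
  define M where "M = max 0 (max ((L (l + s) - z) / s) ((L (l - s) - z) / s))"
  have "(L (l + s) - z) / s \<le> M" "(L (l - s) - z) / s \<le> M" by (auto simp: M_def)
  then have M: "0 \<le> M" "L (l + s) - s * M \<le> z" "L (l - s) - s * M \<le> z"
    using s by (auto simp: M_def field_simps)
  have "Limsup F (tilt l {M..}) \<le> ennreal (exp (- (s * M) + L (l + s)))"
    by (rule chebyshev_tilt[OF s(2)]) (use s in \<open>auto simp: algebra_simps\<close>)
  also have "\<dots> \<le> ennreal (exp z)" using M by (intro ennreal_leI) auto
  finally have 1: "Limsup F (tilt l {M..}) \<le> ennreal (exp z)" .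
  have "Limsup F (tilt l {..- M}) \<le> ennreal (exp (- (s * M) + L (l - s)))"
  proof (rule chebyshev_tilt[OF s(3)])
    fix y assume "y \<in> {..- M}"
    then have "s * y \<le> s * - M" using s by (intro mult_left_mono) auto
    then show "l * y \<le> (l - s) * y + - (s * M)" by (simp add: algebra_simps)
  qed
  also have "\<dots> \<le> ennreal (exp z)" using M by (intro ennreal_leI) auto
  finally have 2: "Limsup F (tilt l {..- M}) \<le> ennreal (exp z)" .
  show ?thesis
    by (rule that[OF M(1)]) (rule order_trans[OF Limsup_tilt_Un], use 1 2 in auto)
qed

text \<open>Covers the case where \<open>interior (Dom _)\<close> is empty, so that the inclusions into the set of
  slopes carry no information.\<close>

lemma l1_le_L_star_singleton:
  assumes G: "G \<noteq> {}" and inf: "\<And>y. y \<noteq> x \<Longrightarrow> \<rho>0 y = \<infinity>"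
  shows "\<rho>1 x \<le> Lstar x"
proof -
  obtain l where l: "l \<in> G" using G by blast
  have "\<rho>1 x \<le> ereal (l * x - L l)"
  proof (rule l1_leI)
    fix e :: real assume e: "0 < e"
    define d where "d = min e (e / (\<bar>l\<bar> + 1))"
    have d: "0 < d" "d \<le> e" "\<bar>l\<bar> * d \<le> e"
    proof -
      show "0 < d" "d \<le> e" using e by (auto simp: d_def)
      have "d \<le> e / (\<bar>l\<bar> + 1)" by (simp add: d_def)
      then have "(\<bar>l\<bar> + 1) * d \<le> e" by (simp add: field_simps)
      then show "\<bar>l\<bar> * d \<le> e" using \<open>0 < d\<close> by (simp add: algebra_simps)
    qed
    \<comment> \<open>Any level strictly below \<open>L l\<close> would serve as the bound for the
      tails.\<close>
    obtain M where M: "0 \<le> M"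
      "Limsup F (tilt l ({..- M} \<union> {M..})) \<le> ennreal (exp (L l - 1))"
      using Limsup_tilt_tails_le[OF l] by blast
    \<comment> \<open>\<open>K\<close> is the compact rest between window and tails. There
      \<open>\<rho>0\<close> is infinite, so the limsup vanishes, and it still does after a tilt
      bounded by \<open>exp (\<bar>l\<bar> * M)\<close>.\<close>
    define K where "K = {- M..M} - {x - d<..<x + d}"
    have K: "compact K" "K \<in> sets borel"
      by (auto simp: K_def intro!: compact_diff)
    have "limsup_pow F \<mu> t K \<le> 0"
    proof (rule limsup_pow_compact_le[OF K(1)])
      fix y assume "y \<in> K"
      then have "y \<noteq> x" using d by (auto simp: K_def)
      then show "eexp (- \<rho>0 y) \<le> 0" using inf by simp
    qed
    moreover have "Limsup F (tilt l K) \<le> ennreal (exp (\<bar>l\<bar> * M)) * Limsup F (tilt 0 K)"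
    proof (rule Limsup_tilt_le_shift)
      fix y assume "y \<in> K"
      then have "\<bar>l\<bar> * \<bar>y\<bar> \<le> \<bar>l\<bar> * M" by (intro mult_left_mono) (auto simp: K_def)
      moreover have "l * y \<le> \<bar>l\<bar> * \<bar>y\<bar>" by (metis abs_ge_self abs_mult)
      ultimately show "l * y \<le> 0 * y + \<bar>l\<bar> * M" by simp
    qed (use K in auto)
    ultimately have "Limsup F (tilt l K) = 0"
      by (simp add: limsup_pow_eq_tilt[OF K(2)])
    then have "Limsup F (tilt l (K \<union> ({..- M} \<union> {M..}))) \<le> ennreal (exp (L l - 1))"
      using Limsup_tilt_Un[of K "{..- M} \<union> {M..}" l] K(2) M(2) by (auto intro: order_trans)
    moreover have "Limsup F (tilt l (- {x - d<..<x + d}))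
        \<le> Limsup F (tilt l (K \<union> ({..- M} \<union> {M..})))"
      by (rule Limsup_tilt_mono) (use K(2) in \<open>auto simp: K_def\<close>)
    moreover have "ennreal (exp (L l - 1)) < ennreal (exp (L l))"
      by (rule ennreal_lessI) auto
    ultimately have "Limsup F (tilt l (- {x - d<..<x + d})) < ennreal (exp (L l))"
      by (meson le_less_trans)
    then show "\<exists>d l'. 0 < d \<and> d \<le> e \<and> l' \<in> G \<and>
      Limsup F (tilt l' (- {x - d<..<x + d})) < ennreal (exp (L l')) \<and>
      l' * x + \<bar>l'\<bar> * d - L l' \<le> l * x - L l + e"
      using d l by (intro exI[of _ d] exI[of _ l]) auto
  qed
  then show ?thesis using le_L_star[OF l] order_trans by blast
qed

text \<open>A closed set is cut into a compact part, subject to the vague bound, and tails that are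
  negligible because \<open>0 \<in> G\<close>.\<close>

lemma narrow_ldp_l0:
  assumes "\<rho>0 = \<rho>1" "0 \<in> G"
  shows "narrow_ldp F \<mu> t \<rho>0"
proof -
  have "limsup_pow F \<mu> t C \<le> (SUP x\<in>C. eexp (- \<rho>0 x))" if C: "closed C" for C
  proof (rule dense_ge)
    fix y assume y: "(SUP x\<in>C. eexp (- \<rho>0 x)) < y"
    \<comment> \<open>Possible because \<open>y\<close> exceeds a supremum in \<open>ennreal\<close>
      and is therefore positive.\<close>
    have "\<exists>z. ennreal (exp z) \<le> y"
    proof (cases y)
      case (real r)
      have "0 < y" using y by (rule le_less_trans[OF zero_le])
      then show ?thesis using real by (intro exI[of _ "ln r"]) auto
    qed auto
    then obtain z where z: "ennreal (exp z) \<le> y" by blast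
    obtain M where M: "Limsup F (tilt 0 ({..- M} \<union> {M..})) \<le> ennreal (exp z)"
      using Limsup_tilt_tails_le[OF assms(2)] by blast
    have "limsup_pow F \<mu> t (C \<inter> {- M..M}) \<le> (SUP x\<in>C. eexp (- \<rho>0 x))"
      by (rule limsup_pow_compact_le) (use C in \<open>auto intro: SUP_upper\<close>)
    moreover have "limsup_pow F \<mu> t ({..- M} \<union> {M..}) \<le> ennreal (exp z)"
      using M by (simp add: limsup_pow_eq_tilt)
    moreover have "limsup_pow F \<mu> t (C \<inter> {- M..M} \<union> ({..- M} \<union> {M..}))
      \<le> max (limsup_pow F \<mu> t (C \<inter> {- M..M})) (limsup_pow F \<mu> t ({..- M} \<union> {M..}))"
      by (rule limsup_pow_Un) (use C in auto)
    moreover have "limsup_pow F \<mu> t C \<le> limsup_pow F \<mu> t (C \<inter> {- M..M} \<union> ({..- M} \<union> {M..}))"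
      by (rule limsup_pow_mono) (use C in auto)
    ultimately show "limsup_pow F \<mu> t C \<le> y"
      using y z by (meson less_imp_le max.boundedI order_trans)
  qed
  then show ?thesis
    using vague_ldp_l0[OF assms(1)] unfolding narrow_ldp_def vague_ldp_def by blast
qed

section \<open>From the interior of the domain to its boundary\<close>

text \<open>Meant for \<open>f\<close> equal to \<open>l0\<close> or \<open>\<Lambda>*\<close>. The
  constant \<open>k\<close> allows for interior points where only \<open>l1 \<le> m\<close> is
  known. If the interior is empty, the domain is a single point and \<open>\<rho>0\<close> is
  infinite elsewhere.\<close>

lemma l1_le_of_interior:
  assumes G: "G \<noteq> {}" and f: "proper_convex f" and lef: "\<And>x. Lstar x \<le> f x" and fle: "\<And>x. f x \<le> \<rho>0 x"
    and int: "\<And>y. y \<in> interior (Dom f) \<Longrightarrow> \<rho>1 y \<le> max (f y) k"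
  shows "\<rho>1 x \<le> max (f x) k"
proof (cases "x \<in> Dom f")
  case True
  show ?thesis
  proof (cases "interior (Dom f) = {}")
    case True
    then obtain y where "Dom f = {y}" using proper_convex_empty_interior[OF f] by blast
    then have D: "Dom f = {x}" using \<open>x \<in> Dom f\<close> by auto
    have "\<rho>0 y = \<infinity>" if "y \<noteq> x" for y
    proof -
      have "f y = \<infinity>" using D that by (auto simp: Dom_def)
      then show ?thesis using fle[of y] by simp
    qed
    then have "\<rho>1 x \<le> Lstar x" by (rule l1_le_L_star_singleton[OF G])
    also note lef
    finally show ?thesis by (simp add: le_max_iff_disj)
  next
    case False
    show ?thesis
      by (rule lsc_le_of_convex_boundary[OF f _ int False True]) (simp add: l1_eq lsc_loc_rate)
  qed
qed (simp add: Dom_def)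

end

section \<open>The eight cases\<close>

theorem theorem3:
  fixes F :: "'i filter"
    and \<mu> :: "'i \<Rightarrow> real measure"
    and t :: "'i \<Rightarrow> real"
    and S :: "(real \<Rightarrow> ereal) set"
    and G :: "real set"
  defines "l0 \<equiv> ell0 F \<mu> t"
    and "l1 \<equiv> ell1 F \<mu> t"
    and "m \<equiv> - Lam_upper F \<mu> t (\<lambda>_. 0)"
    and "LS \<equiv> Lam_star F \<mu> t S"
    and "LG \<equiv> L_star F \<mu> t G"
    and "R \<equiv> slopes F \<mu> t G"
  assumes "F \<noteq> bot"
    and "\<And>i. radon_subprob (\<mu> i)"
    and "\<And>i. t i > 0"
    and "(t \<longlongrightarrow> 0) F"
    and "\<And>h. h \<in> S \<Longrightarrow> continuous_on UNIV h \<and> (\<forall>x. h x < \<infinity>)"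
    and "open G" and "is_interval G" and "G \<noteq> {}"
    and "hlin ` G \<subseteq> S"
    and "\<And>h. h \<in> S \<Longrightarrow> Lam_exists F \<mu> t h"
    and "\<And>l. l \<in> G \<Longrightarrow> \<bar>Lfun F \<mu> t l\<bar> \<noteq> \<infinity>"
  shows
    \<comment> \<open>(a)\<close>
    "(Dom l0 \<inter> {x. l1 x > m} \<subseteq> R \<longrightarrow>
       (\<exists>J. vague_ldp F \<mu> t J \<and>
          (\<forall>x \<in> Dom J \<inter> {x. J x > m}. J x = LG x \<and> LG x = LS x) \<and>
          (0 \<in> G \<longrightarrow> narrow_ldp F \<mu> t J \<and> (\<forall>x \<in> Dom J. J x = LG x \<and> LG x = LS x))))
   \<and> \<comment> \<open>(b)\<close>
     (Dom l0 \<subseteq> R \<longrightarrow>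
       (\<exists>J. vague_ldp F \<mu> t J \<and>
          (\<forall>x \<in> Dom J. J x = LG x \<and> LG x = LS x) \<and>
          (0 \<in> G \<longrightarrow> narrow_ldp F \<mu> t J)))
   \<and> \<comment> \<open>(c)\<close>
     (Dom LS \<inter> {x. l1 x > m} \<subseteq> R \<longrightarrow>
       (\<exists>J. vague_ldp F \<mu> t J \<and>
          (\<forall>x \<in> {x. J x > m}. J x = LS x) \<and>
          (\<forall>x \<in> Dom LS \<inter> {x. J x > m}. J x = LG x) \<and>
          (0 \<in> G \<longrightarrow> narrow_ldp F \<mu> t J \<and> J = LS \<and> (\<forall>x \<in> Dom J. J x = LG x))))
   \<and> \<comment> \<open>(d)\<close>
     (Dom LS \<subseteq> R \<longrightarrow>
       (\<exists>J. vague_ldp F \<mu> t J \<and> J = LS \<and>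
          (\<forall>x \<in> Dom J. J x = LG x) \<and>
          (0 \<in> G \<longrightarrow> narrow_ldp F \<mu> t J)))
   \<and> \<comment> \<open>(e)\<close>
     (proper_convex l0 \<longrightarrow>
       (interior (Dom l0) \<inter> {x. l1 x > m} \<subseteq> R \<longrightarrow>
         (\<exists>J. vague_ldp F \<mu> t J \<and>
            (\<forall>x \<in> interior (Dom J) \<inter> {x. J x > m}. J x = LG x \<and> LG x = LS x) \<and>
            (0 \<in> G \<longrightarrow> narrow_ldp F \<mu> t J \<and>
               (\<forall>x \<in> interior (Dom J). J x = LG x \<and> LG x = LS x)))) \<and>
       (interior (Dom l0) \<subseteq> R \<longrightarrow>
         (\<exists>J. vague_ldp F \<mu> t J \<and>
            (\<forall>x \<in> interior (Dom J). J x = LG x \<and> LG x = LS x) \<and>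
            (0 \<in> G \<longrightarrow> narrow_ldp F \<mu> t J))))
   \<and> \<comment> \<open>(f)\<close>
     (proper_convex LS \<and> lsc LS \<longrightarrow>
       (interior (Dom LS) \<inter> {x. l1 x > m} \<subseteq> R \<longrightarrow>
         (\<exists>J. vague_ldp F \<mu> t J \<and>
            (\<forall>x \<in> {x. J x > m}. J x = LS x) \<and>
            (\<forall>x \<in> interior (Dom LS) \<inter> {x. J x > m}. J x = LG x) \<and>
            (0 \<in> G \<longrightarrow> narrow_ldp F \<mu> t J \<and> J = LS \<and>
               (\<forall>x \<in> interior (Dom J). J x = LG x)))) \<and>
       (interior (Dom LS) \<subseteq> R \<longrightarrow>
         (\<exists>J. vague_ldp F \<mu> t J \<and> J = LS \<and>
            (\<forall>x \<in> interior (Dom J). J x = LG x) \<and>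
            (0 \<in> G \<longrightarrow> narrow_ldp F \<mu> t J))))"
proof -
  interpret laplace_net_line F \<mu> t G
    by (intro laplace_net_line.intro laplace_net.intro laplace_net_line_axioms.intro)
      (use assms(7-) in \<open>auto simp: radon_subprob_def\<close>)
  note defs = l0_def l1_def m_def LS_def LG_def R_def
  have GS: "LG x \<le> LS x" and S0: "LS x \<le> l0 x" and le01: "l0 x \<le> l1 x" and m0: "m \<le> l0 x" for x
    unfolding defs
    using L_star_le_Lam_star[OF \<open>hlin ` G \<subseteq> S\<close>, of x] Lam_star_le_l0[OF assms(11), of S x]
      l0_le_l1[of x] m_le_l0[of x] by blast+
  have inR: "l1 x \<le> LG x" if "x \<in> R" for x
    using that l1_le_L_star_slopes unfolding defs by blast
  \<comment> \<open>\<open>inR\<close> closes the chain \<open>LG \<le> LS \<le> l0 \<le> l1\<close>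
    into equalities.\<close>
  have eqR: "LS x = LG x" "l0 x = LG x" "l1 x = LG x" if "x \<in> R" for x
    using inR[OF that] GS[of x] S0[of x] le01[of x] by (auto intro!: antisym)
  have mG: "m \<le> LG x" if "0 \<in> G" for x
    using m_le_L_star[OF that] unfolding defs by blast
  have ldp: "vague_ldp F \<mu> t l0" "0 \<in> G \<Longrightarrow> narrow_ldp F \<mu> t l0" if "\<And>x. l1 x \<le> l0 x"
  proof -
    have "l0 = l1" using that le01 by (auto simp: fun_eq_iff intro!: antisym)
    then show "vague_ldp F \<mu> t l0" "0 \<in> G \<Longrightarrow> narrow_ldp F \<mu> t l0"
      unfolding defs by (rule vague_ldp_l0, rule narrow_ldp_l0)
  qed
  \<comment> \<open>With \<open>0 \<in> G\<close> the chain starts at \<open>m\<close>, so it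
    collapses wherever \<open>l0\<close> does not exceed \<open>m\<close>.\<close>
  have eq_m: "LG x = m" "LS x = m" "l0 x = m" if "0 \<in> G" "\<not> m < l0 x" for x
    using mG[OF that(1), of x] GS[of x] S0[of x] that(2) by (auto intro!: antisym)
  have clos0: "l1 x \<le> l0 x"
    if "proper_convex l0" "\<And>y. y \<in> interior (Dom l0) \<Longrightarrow> l1 y \<le> max (l0 y) m" for x
    using l1_le_of_interior[OF assms(14), of l0 m x] that GS S0 m0[of x] order_trans[OF GS S0]
    unfolding defs by (auto simp: max_absorb1)
  have closS: "l1 x \<le> max (LS x) k"
    if "proper_convex LS" "\<And>y. y \<in> interior (Dom LS) \<Longrightarrow> l1 y \<le> max (LS y) k" for x k
    using l1_le_of_interior[OF assms(14), of LS k x] that GS S0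
    unfolding defs by blast
  have less01: "m < l0 x \<Longrightarrow> m < l1 x" for x
    using le01[of x] by (rule less_le_trans[rotated])
  show ?thesis
  proof (intro conjI impI, goal_cases)
    case 1
    have "l1 x \<le> l0 x" for x
    proof (cases "x \<in> R")
      case False
      \<comment> \<open>A point outside \<open>R\<close> fails one of the two conditions in the
        inclusion; when \<open>l1 x \<le> m\<close>, the bound \<open>m \<le> l0 x\<close>
        finishes.\<close>
      then have "l0 x = \<infinity> \<or> l1 x \<le> m" using 1 by (auto simp: Dom_def not_less)
      then show ?thesis using m0[of x] by auto
    qed (simp add: eqR)
    moreover have "l0 x = LG x \<and> LG x = LS x" if "x \<in> Dom l0" "m < l0 x" for x
      using 1 that less01 eqR[of x] by auto
    moreover have "l0 x = LG x \<and> LG x = LS x" if "x \<in> Dom l0" "0 \<in> G" for x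
      using calculation(2)[OF that(1)] eq_m[OF that(2)] by (cases "m < l0 x") auto
    ultimately show ?case using ldp by (intro exI[of _ l0]) blast
  next
    case 2
    have "l1 x \<le> l0 x" for x
    proof (cases "x \<in> R")
      case False
      then have "l0 x = \<infinity>" using 2 by (auto simp: Dom_def)
      then show ?thesis by simp
    qed (simp add: eqR)
    moreover have "l0 x = LG x \<and> LG x = LS x" if "x \<in> Dom l0" for x
      using 2 that eqR[of x] by auto
    ultimately show ?case using ldp by (intro exI[of _ l0]) blast
  next
    case 3
    \<comment> \<open>Since \<open>LS \<le> l0\<close>, points outside \<open>Dom LS\<close> satisfy
      \<open>l1 \<le> l0\<close> trivially.\<close>
    have top: "l0 x = \<infinity>" if "x \<notin> Dom LS" for x
      using that S0[of x] by (simp add: Dom_def)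
    have le: "l1 x \<le> l0 x" for x
    proof (cases "x \<in> R")
      case False
      then have "l0 x = \<infinity> \<or> l1 x \<le> m" using 3 top[of x] not_less by blast
      then show ?thesis using m0[of x] by auto
    qed (simp add: eqR)
    have S: "l0 x = LS x" if "m < l0 x" for x
      using 3 that less01 eqR[of x] top[of x] by (cases "x \<in> Dom LS") (auto simp: Dom_def)
    have D: "l0 x = LG x" if "x \<in> Dom LS" "m < l0 x" for x
      using 3 that less01 eqR[of x] by auto
    have J: "l0 = LS" if "0 \<in> G"
    proof
      show "l0 x = LS x" for x
        using S[of x] eq_m[OF that, of x] by (cases "m < l0 x") simp_all
    qed
    have DJ: "l0 x = LG x" if "0 \<in> G" "x \<in> Dom l0" for x
    proof (cases "m < l0 x")
      case True
      have "x \<in> Dom LS"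
        using that(2) by (simp only: J[OF that(1), symmetric])
      then show ?thesis by (rule D[OF _ True])
    qed (simp add: eq_m[OF that(1)])
    show ?case
    proof (intro exI[of _ l0] conjI ballI impI)
      show "l0 x = LS x" if "x \<in> {x. m < l0 x}" for x using that S by simp
      show "l0 x = LG x" if "x \<in> Dom LS \<inter> {x. m < l0 x}" for x using that D by simp
      show "l0 x = LG x" if "0 \<in> G" "x \<in> Dom l0" for x using that by (rule DJ)
    qed (use ldp[OF le] J in auto)
  next
    case 4
    have top: "LS x = \<infinity>" "l0 x = \<infinity>" if "x \<notin> Dom LS" for x
      using that S0[of x] by (simp_all add: Dom_def)
    have le: "l1 x \<le> l0 x" for x
      using 4 eqR[of x] top[of x] by (cases "x \<in> Dom LS") auto
    have "l0 x = LS x" for x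
      using 4 eqR[of x] top[of x] by (cases "x \<in> Dom LS") auto
    then have "l0 = LS" by blast
    moreover have "l0 x = LG x" if "x \<in> Dom LS" for x
      using 4 that eqR[of x] by auto
    ultimately show ?case using ldp[OF le] by (intro exI[of _ l0]) auto
  next
    case 5
    have "l1 y \<le> max (l0 y) m" if "y \<in> interior (Dom l0)" for y
      using 5(2) that eqR[of y] by (cases "m < l1 y") (auto simp: le_max_iff_disj)
    from clos0[OF 5(1) this] have le: "l1 x \<le> l0 x" for x .
    have "l0 x = LG x \<and> LG x = LS x" if "x \<in> interior (Dom l0)" "m < l0 x" for x
      using 5(2) that less01 eqR[of x] by auto
    moreover have "l0 x = LG x \<and> LG x = LS x" if "x \<in> interior (Dom l0)" "0 \<in> G" for x
      using calculation[OF that(1)] eq_m[OF that(2)] by (cases "m < l0 x") auto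
    ultimately show ?case using ldp[OF le] by (intro exI[of _ l0]) blast
  next
    case 6
    have "l1 y \<le> max (l0 y) m" if "y \<in> interior (Dom l0)" for y
      using 6(2) that eqR[of y] by (auto simp: le_max_iff_disj)
    from clos0[OF 6(1) this] have le: "l1 x \<le> l0 x" for x .
    have "l0 x = LG x \<and> LG x = LS x" if "x \<in> interior (Dom l0)" for x
      using 6(2) that eqR[of x] by auto
    then show ?case using ldp[OF le] by (intro exI[of _ l0]) blast
  next
    case 7
    have "l1 y \<le> max (LS y) m" if "y \<in> interior (Dom LS)" for y
      using 7(2) that eqR[of y] by (cases "m < l1 y") (auto simp: le_max_iff_disj)
    \<comment> \<open>Used twice: both terms of the maximum are at most \<open>l0\<close>, and where
      \<open>l0 > m\<close> the maximum must be \<open>LS\<close>.\<close>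
    from closS[OF conjunct1[OF 7(1)] this] have max: "l1 x \<le> max (LS x) m" for x .
    have le: "l1 x \<le> l0 x" for x
      using max[of x] by (rule order_trans) (simp add: S0 m0)
    have S: "l0 x = LS x" if "m < l0 x" for x
      using max[of x] less01[OF that] le01[of x] S0[of x] by (auto simp: le_max_iff_disj)
    have D: "l0 x = LG x" if "x \<in> interior (Dom LS)" "m < l0 x" for x
      using 7(2) that less01 eqR[of x] by auto
    have J: "l0 = LS" if "0 \<in> G"
    proof
      show "l0 x = LS x" for x
        using S[of x] eq_m[OF that, of x] by (cases "m < l0 x") simp_all
    qed
    have DJ: "l0 x = LG x" if "0 \<in> G" "x \<in> interior (Dom l0)" for x
    proof (cases "m < l0 x")
      case True
      have "x \<in> interior (Dom LS)"
        using that(2) by (simp only: J[OF that(1), symmetric])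
      then show ?thesis by (rule D[OF _ True])
    qed (simp add: eq_m[OF that(1)])
    show ?case
    proof (intro exI[of _ l0] conjI ballI impI)
      show "l0 x = LS x" if "x \<in> {x. m < l0 x}" for x using that S by simp
      show "l0 x = LG x" if "x \<in> interior (Dom LS) \<inter> {x. m < l0 x}" for x using that D by simp
      show "l0 x = LG x" if "0 \<in> G" "x \<in> interior (Dom l0)" for x using that by (rule DJ)
    qed (use ldp[OF le] J in auto)
  next
    case 8
    \<comment> \<open>All interior points lie in \<open>R\<close>, so \<open>- \<infinity>\<close>
      replaces \<open>m\<close> and the maximum reduces to \<open>LS\<close>.\<close>
    have "l1 y \<le> max (LS y) (- \<infinity>)" if "y \<in> interior (Dom LS)" for y
      using 8(2) that eqR[of y] by (auto simp: le_max_iff_disj)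
    from closS[OF conjunct1[OF 8(1)] this] have lS: "l1 x \<le> LS x" for x by simp
    then have le: "l1 x \<le> l0 x" for x using S0 order_trans by blast
    have "l0 x = LS x" for x
      using lS[of x] le01[of x] S0[of x] by (auto intro: antisym order_trans)
    then have "l0 = LS" by blast
    moreover have "l0 x = LG x" if "x \<in> interior (Dom LS)" for x
      using 8(2) that eqR[of x] by auto
    ultimately show ?case using ldp[OF le] by (intro exI[of _ l0]) auto
  qed
qed

end
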